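(* Let $n > 3f$ and $\kappa \ge 0$. The quick order-fair atomic broadcast protocol with parameter $\kappa$ (defined in the context), run by $n$ processes of which up to $f$ are Byzantine, implements $\kappa$-differentially order-fair atomic broadcast.
   Context: **System model.** Processes $p_1,\dots,p_n$ (the set $\mathcal{P}$) communicate over reliable, authenticated, FIFO point-to-point links; the network is asynchronous or partially synchronous. Up to $f$ processes are Byzantine (they may crash or deviate arbitrarily from the protocol); the others are correct, and $n-f$ of them are counted below. Processes are computationally bounded; a digital signature scheme is available. $\mathcal{M}$ is the domain of payload messages. **Problem.** In $\kappa$-differentially order-fair atomic broadcast, processes invoke of-broadcast$(m)$ for $m\in\mathcal{M}$ and output events of-deliver$(S)$, where $S\subseteq\mathcal{M}$ is a set of payloads delivered at the same time (payloads output in the same event are not delivered one before the other). For $m,m'$ of-broadcast by correct processes, $b(m,m')$ is the number of correct processes that of-broadcast $m$ before $m'$. Standing assumption: if one correct process of-broadcasts $m$, then every correct process eventually of-broadcasts $m$; hence $b(m,m')+b(m',m)=n-f$. The required properties are: - No duplication: no message is of-delivered more than once. - Agreement: if $m$ is of-delivered by some correct process, then $m$ is eventually of-delivered by every correct process. - Total order: if correct $p_i, p_j$ both of-deliver $m$ and $m'$, and $p_i$ of-delivers $m$ before $m'$, then $p_j$ also of-delivers $m$ before $m'$. - Weak validity: if all processes are correct and of-broadcast a finite number of messages, then every correct process eventually of-delivers all of these messages. - $\kappa$-differential order fairness: if $b(m,m') > b(m',m) + 2f + \kappa$, then no correct process of-delivers $m'$ before $m$. **Primitive 1: Byzantine FIFO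 consistent broadcast channel (BCCH).** Events bcch-broadcast$(m)$ and bcch-deliver$(p_j,l,m)$ (message $m$ with label $l$, a bit string generated by the channel, from sender $p_j$). Properties: - Validity: if a correct process broadcasts $m$, every correct process eventually delivers $m$. - No duplication: for every sender $p_j$ and label $l$, every correct process delivers at most one message with label $l$ and sender $p_j$. - Integrity: if a correct process delivers $m$ with sender $p_j$ and $p_j$ is correct, then $m$ was previously broadcast by $p_j$. - Consistency: if two correct processes deliver $m$ and $m'$, respectively, with the same label and the same sender, then $m=m'$. - FIFO delivery: if a correct process broadcasts $m$ before $m'$, no correct process delivers $m'$ unless it has already delivered $m$. The channel can be implemented by running, for every sender, a sequence of consistent broadcast instances, exactly one active at a time, with the per-sender sequence number as label. It also offers methods for verifiable transfer of messages: bcch-create-proof applied to a list of messages outputs a string $s$ containing the messages and a proof; bcch-verify-proof$(s)$ verifies the proof, and it is impossible to forge a proof for a message that was not bcch-delivered; bcch-get-length$(s)$ and bcch-get-messages$(s)$ return the number of payload messages in $s$ and the messages themselves. **Primitive 2: validated Byzantine consensus (VBC) with predicate $P$.** Events vbc-propose$(v)$, vbc-decide$(v)$. Properties: Termination (every correct process eventually decides some value; for asynchronous implementations this may hold only probabilistically); Integrity (no correct process decides twice); Agreement (no two correct processes decide differently); External validity (every correct process only decides $v$ with $P(v)=$ true; moreover, if all processes are correct and propose $v$, no correct process decides a value different from $v$). **The protocol (code for $p_i$).** State: round number $r=1$; flag $inround=$ false; for each $j\in\{1,\dots,n\}$ a list $msgs[j]$ (initially empty, positions numbered from 1) and a counter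 $vc[j]=0$; an $n\times n$ matrix $L=0$; a list $\Sigma$ of $n$ signatures, initially all undefined; $cut=[0]^n$; $delivered=\emptyset$. 1. Upon of-broadcast$(m)$: bcch-broadcast$(m)$. 2. Upon bcch-deliver$(p_j,l,m)$: $vc[j]\gets vc[j]+1$; append $m$ to $msgs[j]$. 3. Upon existence of $j$ with $|msgs[j]|>cut[j]$ while $inround$ is false: set $inround$ to true, sign $vc$ giving $\sigma$, and send [STATUS, $r$, $vc$, $\sigma$] to all processes. 4. Upon receiving [STATUS, $r'$, $vc'$, $\sigma'$] from $p_j$ such that $r'=r$ and $\sigma'$ is a valid signature by $p_j$ on $vc'$: $L[j]\gets vc'$ (row $j$), $\Sigma[j]\gets\sigma'$. 5. Upon at least $n-f$ entries of $\Sigma$ being defined: vbc-propose $(L,\Sigma)$ in the VBC instance of round $r$, then reset $\Sigma$ to all undefined. The VBC predicate accepts $(L,\Sigma)$ iff for at least $n-f$ values $j$ the entry $\Sigma[j]$ is a valid signature (by $p_j$) on row $j$ of $L$. 6. Upon vbc-decide $(L',\Sigma')$ in round $r$: for each $j$ let $cut[j]$ be the largest $s$ such that at least $f+1$ entries of column $j$ of $L'$ are $\ge s$. Then for every $j$ with $vc[j]<cut[j]$, send [MISSING, $r$, $j$, $vc[j]$] to all processes. 7. Upon receiving [MISSING, $r'$, $k$, $index$] from $p_j$ such that $r'=r$: if $vc[k]\ge cut[k]$, let $resend$ be the requested payloads of $msgs[k]$ (those after position $index$, up to position $cut[k]$), let $s\gets$ bcch-create-proof$(resend)$, and send [RESEND,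 $r$, $k$, $s$] to $p_j$. 8. Upon receiving [RESEND, $r'$, $k$, $s'$] from $p_j$ such that $r'=r$ and $|msgs[k]|<cut[k]$: if bcch-verify-proof$(s')$ holds, increase $vc[k]$ by bcch-get-length$(s')$ and append bcch-get-messages$(s')$ to $msgs[k]$. 9. Upon $|msgs[j]|\ge cut[j]$ for all $j\in\{1,\dots,n\}$ (with the cut of round $r$ having been determined in step 6): - Let $V=\bigl(\bigcup_j msgs[j][1\dots cut[j]]\bigr)\setminus delivered$. - For distinct $m,m'\in V$ let $M[m][m']$ be the number of $j$ such that $m$ and $m'$ both occur in $msgs[j][1\dots cut[j]]$ and $m$ appears before $m'$ there (each $j$ contributes to at most one of $M[m][m']$, $M[m'][m]$); let $C[m]$ be the number of $j$ such that $m$ occurs in $msgs[j][1\dots cut[j]]$. - Let $E=\{(m,m') : \max\{M[m][m'],\, n-f-M[m'][m]\} > M[m'][m]-f+\kappa\}$. - Let $H=(W,F)$ be obtained from the directed graph $(V,E)$ by repeatedly collapsing strongly connected subgraphs into single vertices by edge contraction, until no cycle remains. A vertex $w$ is thus a payload or a (recursive) set of sets of payloads; flatten$(w)$ is the set of all payloads merged into $w$; $w$ is stable if every payload $m\in$ flatten$(w)$ satisfies $C[m]\ge\frac{n+f-\kappa}{2}$. - While $W$ contains a stable vertex without incoming edges: take such a $w$ in a fixed deterministic order, of-deliver(flatten$(w)$), add flatten$(w)$ to $delivered$, and remove $w$ from the graph. - Reset $L$ to $0$, set $inround$ to false, and set $r\gets r+1$.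
   Formalization: Protocol mended: MISSING requests of earlier rounds are also answered, using that round's cut; RESEND appends only messages continuing the sender's label sequence. VBC is also assumed to decide only proposed values when all processes are correct. *)

theory Defs
  imports Complex_Main "HOL-Library.Cardinality"
begin

section \<open>Order-fair atomic broadcast as a property of histories\<close>

text \<open>
  The processes are the elements of the finite type \<open>'p\<close>, so \<open>n = CARD('p)\<close>.
  A history of an order-fair atomic broadcast consists of a predicate \<open>bc\<close>, where \<open>bc t p m\<close> says
  that \<open>p\<close> invokes of-broadcast\<open>(m)\<close> at time \<open>t\<close>, and a function \<open>lg\<close>, where \<open>lg t p\<close> is the
  list of all sets that \<open>p\<close> has of-delivered before time \<open>t\<close>, one entry per of-deliver event.
\<close>

text \<open>If \<open>p\<close> broadcasts a payload repeatedly, its first broadcast counts.\<close>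

definition bc_before :: "(nat \<Rightarrow> 'p \<Rightarrow> 'm \<Rightarrow> bool) \<Rightarrow> 'p \<Rightarrow> 'm \<Rightarrow> 'm \<Rightarrow> bool" where
  "bc_before bc p m m' \<longleftrightarrow> (\<exists>t. bc t p m \<and> (\<forall>t'\<le>t. \<not> bc t' p m'))"

definition bc_count :: "(nat \<Rightarrow> 'p \<Rightarrow> 'm \<Rightarrow> bool) \<Rightarrow> 'p set \<Rightarrow> 'm \<Rightarrow> 'm \<Rightarrow> nat" where
  "bc_count bc K m m' = card {p \<in> K. bc_before bc p m m'}"

definition of_delivers :: "(nat \<Rightarrow> 'p \<Rightarrow> 'm set list) \<Rightarrow> 'p \<Rightarrow> 'm \<Rightarrow> bool" where
  "of_delivers lg p m \<longleftrightarrow> (\<exists>t. m \<in> \<Union> (set (lg t p)))"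

text \<open>
  Of-delivering \<open>m\<close> before \<open>m'\<close>: \<open>m\<close> is output while \<open>m'\<close> has neither been output earlier nor is
  output in the same event. This includes the case that \<open>m'\<close> is never output.
\<close>

definition of_before :: "(nat \<Rightarrow> 'p \<Rightarrow> 'm set list) \<Rightarrow> 'p \<Rightarrow> 'm \<Rightarrow> 'm \<Rightarrow> bool" where
  "of_before lg p m m' \<longleftrightarrow>
     (\<exists>t i. i < length (lg t p) \<and> m \<in> lg t p ! i \<and> (\<forall>j\<le>i. m' \<notin> lg t p ! j))"

definition of_no_duplication :: "'p set \<Rightarrow> (nat \<Rightarrow> 'p \<Rightarrow> 'm set list) \<Rightarrow> bool" where
  "of_no_duplication Cor lg \<longleftrightarrow>
     (\<forall>p\<in>Cor. \<forall>t m i j. i < length (lg t p) \<and> j < length (lg t p) \<and>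
        m \<in> lg t p ! i \<and> m \<in> lg t p ! j \<longrightarrow> i = j)"

definition of_agreement :: "'p set \<Rightarrow> (nat \<Rightarrow> 'p \<Rightarrow> 'm set list) \<Rightarrow> bool" where
  "of_agreement Cor lg \<longleftrightarrow>
     (\<forall>p\<in>Cor. \<forall>q\<in>Cor. \<forall>m. of_delivers lg p m \<longrightarrow> of_delivers lg q m)"

definition of_total_order :: "'p set \<Rightarrow> (nat \<Rightarrow> 'p \<Rightarrow> 'm set list) \<Rightarrow> bool" where
  "of_total_order Cor lg \<longleftrightarrow>
     (\<forall>p\<in>Cor. \<forall>q\<in>Cor. \<forall>m m'.
        of_delivers lg p m \<and> of_delivers lg p m' \<and> of_delivers lg q m \<and> of_delivers lg q m' \<and>
        of_before lg p m m' \<longrightarrow> of_before lg q m m')"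

definition of_weak_validity ::
  "'p set \<Rightarrow> (nat \<Rightarrow> 'p \<Rightarrow> 'm \<Rightarrow> bool) \<Rightarrow> (nat \<Rightarrow> 'p \<Rightarrow> 'm set list) \<Rightarrow> bool" where
  "of_weak_validity Cor bc lg \<longleftrightarrow>
     (Cor = UNIV \<and> finite {m. \<exists>t p. bc t p m} \<longrightarrow>
        (\<forall>p m. (\<exists>t q. bc t q m) \<longrightarrow> of_delivers lg p m))"

text \<open>
  The set \<open>K\<close> contains the correct processes that are counted. With exactly \<open>f\<close> faulty processes
  the only choice is \<open>K = Cor\<close>; with fewer, fairness is required both for the count over all
  correct processes and for the count over any \<open>n - f\<close> of them.
\<close>

definition of_differential_order_fairness ::
  "nat \<Rightarrow> real \<Rightarrow> 'p::finite set \<Rightarrow> (nat \<Rightarrow> 'p \<Rightarrow> 'm \<Rightarrow> bool) \<Rightarrow> (nat \<Rightarrow> 'p \<Rightarrow> 'm set list) \<Rightarrow> bool"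
where
  "of_differential_order_fairness f \<kappa> Cor bc lg \<longleftrightarrow>
     (\<forall>K m m'. K \<subseteq> Cor \<and> CARD('p) - f \<le> card K \<and>
        (\<exists>p\<in>Cor. \<exists>t. bc t p m) \<and> (\<exists>p\<in>Cor. \<exists>t. bc t p m') \<and>
        real (bc_count bc K m m') > real (bc_count bc K m' m) + 2 * real f + \<kappa> \<longrightarrow>
        (\<forall>p\<in>Cor. \<not> of_before lg p m' m))"

definition differentially_order_fair_atomic_broadcast ::
  "nat \<Rightarrow> real \<Rightarrow> 'p::finite set \<Rightarrow> (nat \<Rightarrow> 'p \<Rightarrow> 'm \<Rightarrow> bool) \<Rightarrow> (nat \<Rightarrow> 'p \<Rightarrow> 'm set list) \<Rightarrow> bool"
where
  "differentially_order_fair_atomic_broadcast f \<kappa> Cor bc lg \<longleftrightarrow>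
     of_no_duplication Cor lg \<and>
     of_agreement Cor lg \<and>
     of_total_order Cor lg \<and>
     of_weak_validity Cor bc lg \<and>
     of_differential_order_fairness f \<kappa> Cor bc lg"

definition all_correct_broadcast :: "'p set \<Rightarrow> (nat \<Rightarrow> 'p \<Rightarrow> 'm \<Rightarrow> bool) \<Rightarrow> bool" where
  "all_correct_broadcast Cor bc \<longleftrightarrow>
     (\<forall>m. (\<exists>p\<in>Cor. \<exists>t. bc t p m) \<longrightarrow> (\<forall>p\<in>Cor. \<exists>t. bc t p m))"


section \<open>Parameters, messages and local states of the protocol\<close>

text \<open>A value proposed to validated Byzantine consensus: the matrix of vector clocks (a row per
  process) and the list of signatures.\<close>

type_synonym ('p, 'sig) vbc_value = "('p \<Rightarrow> 'p \<Rightarrow> nat) \<times> ('p \<Rightarrow> 'sig option)"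

text \<open>
  Messages on the broadcast channel are identified by sender, label and payload; the label is the
  per-sender sequence number, starting from 1. Proof strings are of type \<open>'str\<close>, and
  \<open>proof_contents\<close> returns the identified messages contained in such a string. The function
  \<open>select\<close> is the fixed deterministic rule by which the next vertex is taken.
\<close>

record ('p, 'm, 'sig, 'str) params =
  faults :: nat
  kappa :: real
  sign :: "'p \<Rightarrow> ('p \<Rightarrow> nat) \<Rightarrow> 'sig"
  verifysig :: "'p \<Rightarrow> ('p \<Rightarrow> nat) \<Rightarrow> 'sig \<Rightarrow> bool"
  create_proof :: "('p \<times> nat \<times> 'm) list \<Rightarrow> 'str"
  verify_proof :: "'str \<Rightarrow> bool"
  proof_contents :: "'str \<Rightarrow> ('p \<times> nat \<times> 'm) list"
  select :: "'m set set \<Rightarrow> 'm set"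

definition params_ok :: "('p, 'm, 'sig, 'str) params \<Rightarrow> bool" where
  "params_ok \<pi> \<longleftrightarrow>
     (\<forall>p v. verifysig \<pi> p v (sign \<pi> p v)) \<and>
     (\<forall>xs. verify_proof \<pi> (create_proof \<pi> xs) \<and> proof_contents \<pi> (create_proof \<pi> xs) = xs) \<and>
     (\<forall>X. X \<noteq> {} \<longrightarrow> select \<pi> X \<in> X)"

datatype ('p, 'sig, 'str) msg =
    STATUS nat "'p \<Rightarrow> nat" 'sig
  | MISSING nat 'p nat
  | RESEND nat 'p 'str

text \<open>
  Besides the variables of the protocol, a local state contains the network messages that have
  arrived and wait for their handler (\<open>inbox\<close>), the decisions output by the consensus instances
  (\<open>decision\<close>), the cut of every round in which it has been determined (\<open>cuts\<close>), and the list of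
  all of-deliver events so far (\<open>olog\<close>).
\<close>

record ('p, 'm, 'sig, 'str) lstate =
  rnd :: nat
  inround :: bool
  msgs :: "'p \<Rightarrow> 'm list"
  vc :: "'p \<Rightarrow> nat"
  Lmat :: "'p \<Rightarrow> 'p \<Rightarrow> nat"
  Sigma :: "'p \<Rightarrow> 'sig option"
  cut :: "'p \<Rightarrow> nat"
  delivered :: "'m set"
  inbox :: "('p \<times> ('p, 'sig, 'str) msg) set"
  decision :: "nat \<Rightarrow> ('p, 'sig) vbc_value option"
  cuts :: "nat \<Rightarrow> ('p \<Rightarrow> nat) option"
  olog :: "'m set list"

definition init_state :: "('p, 'm, 'sig, 'str) lstate" where
  "init_state =
     \<lparr> rnd = 1, inround = False, msgs = (\<lambda>_. []), vc = (\<lambda>_. 0), Lmat = (\<lambda>_ _. 0),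
       Sigma = (\<lambda>_. None), cut = (\<lambda>_. 0), delivered = {}, inbox = {}, decision = (\<lambda>_. None),
       cuts = (\<lambda>_. None), olog = [] \<rparr>"


section \<open>The graph of a round\<close>

text \<open>\<open>ls j\<close> stands for the prefix of \<open>msgs[j]\<close> up to the cut. A payload may occur repeatedly in the
  list of a Byzantine sender; its first occurrence counts.\<close>

definition occurs_before :: "'m list \<Rightarrow> 'm \<Rightarrow> 'm \<Rightarrow> bool" where
  "occurs_before xs m m' \<longleftrightarrow>
     (\<exists>ys zs. xs = ys @ m # zs \<and> m \<notin> set ys \<and> m' \<notin> set ys \<and> m \<noteq> m' \<and> m' \<in> set zs)"

definition M_count :: "('p \<Rightarrow> 'm list) \<Rightarrow> 'm \<Rightarrow> 'm \<Rightarrow> nat" where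
  "M_count ls m m' = card {j. occurs_before (ls j) m m'}"

definition C_count :: "('p \<Rightarrow> 'm list) \<Rightarrow> 'm \<Rightarrow> nat" where
  "C_count ls m = card {j. m \<in> set (ls j)}"

definition order_edges ::
  "nat \<Rightarrow> real \<Rightarrow> ('p::finite \<Rightarrow> 'm list) \<Rightarrow> 'm set \<Rightarrow> ('m \<times> 'm) set" where
  "order_edges f \<kappa> ls V =
     {(m, m'). m \<in> V \<and> m' \<in> V \<and> m \<noteq> m' \<and>
        max (real (M_count ls m m')) (real CARD('p) - real f - real (M_count ls m' m))
          > real (M_count ls m' m) - real f + \<kappa>}"

text \<open>A vertex of a collapsed graph is represented by the flattened set of the payloads merged
  into it; a payload that has not been merged is represented by a singleton.\<close>

type_synonym 'm graph = "'m set set \<times> ('m set \<times> 'm set) set"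

definition payload_graph :: "'m set \<Rightarrow> ('m \<times> 'm) set \<Rightarrow> 'm graph" where
  "payload_graph V E = ((\<lambda>m. {m}) ` V, (\<lambda>(m, m'). ({m}, {m'})) ` E)"

definition contract :: "'m set set \<Rightarrow> 'm graph \<Rightarrow> 'm graph" where
  "contract S G =
     (let \<phi> = (\<lambda>w. if w \<in> S then \<Union> S else w)
      in (\<phi> ` fst G, {(\<phi> a, \<phi> b) | a b. (a, b) \<in> snd G \<and> \<phi> a \<noteq> \<phi> b}))"

inductive collapse_step :: "'m graph \<Rightarrow> 'm graph \<Rightarrow> bool" where
  "\<lbrakk> S \<subseteq> fst G; card S \<ge> 2; \<forall>a\<in>S. \<forall>b\<in>S. (a, b) \<in> (snd G \<inter> S \<times> S)\<^sup>* \<rbrakk>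
     \<Longrightarrow> collapse_step G (contract S G)"

definition collapsed :: "'m graph \<Rightarrow> 'm graph \<Rightarrow> bool" where
  "collapsed G H \<longleftrightarrow> collapse_step\<^sup>*\<^sup>* G H \<and> acyclic (snd H)"

definition stable :: "nat \<Rightarrow> real \<Rightarrow> ('p::finite \<Rightarrow> 'm list) \<Rightarrow> 'm set \<Rightarrow> bool" where
  "stable f \<kappa> ls w \<longleftrightarrow>
     (\<forall>m\<in>w. real (C_count ls m) \<ge> (real CARD('p) + real f - \<kappa>) / 2)"

definition deliverable :: "('m set \<Rightarrow> bool) \<Rightarrow> 'm graph \<Rightarrow> 'm set set" where
  "deliverable stb G = {w \<in> fst G. stb w \<and> (\<forall>u. (u, w) \<notin> snd G)}"

definition remove_vertex :: "'m set \<Rightarrow> 'm graph \<Rightarrow> 'm graph" where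
  "remove_vertex w G = (fst G - {w}, {(a, b) \<in> snd G. a \<noteq> w \<and> b \<noteq> w})"

text \<open>\<open>deliver_loop sel stb G ws\<close>: the loop at the end of a round, started on \<open>G\<close>, terminates
  after having of-delivered the sets \<open>ws\<close> in this order.\<close>

inductive deliver_loop ::
  "('m set set \<Rightarrow> 'm set) \<Rightarrow> ('m set \<Rightarrow> bool) \<Rightarrow> 'm graph \<Rightarrow> 'm set list \<Rightarrow> bool"
  for sel stb where
  stop: "deliverable stb G = {} \<Longrightarrow> deliver_loop sel stb G []"
| take: "\<lbrakk> deliverable stb G \<noteq> {}; w = sel (deliverable stb G);
           deliver_loop sel stb (remove_vertex w G) ws \<rbrakk>
         \<Longrightarrow> deliver_loop sel stb G (w # ws)"


section \<open>Local steps of a correct process\<close>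

definition vbc_predicate :: "('p::finite, 'm, 'sig, 'str) params \<Rightarrow> ('p, 'sig) vbc_value \<Rightarrow> bool"
where
  "vbc_predicate \<pi> v \<longleftrightarrow>
     card {j. \<exists>\<sigma>. snd v j = Some \<sigma> \<and> verifysig \<pi> j (fst v j) \<sigma>} \<ge> CARD('p) - faults \<pi>"

definition cut_of :: "nat \<Rightarrow> ('p \<Rightarrow> 'p \<Rightarrow> nat) \<Rightarrow> 'p \<Rightarrow> nat" where
  "cut_of f L' j = (GREATEST s. f + 1 \<le> card {i. s \<le> L' i j})"

definition resend_list :: "'p \<Rightarrow> 'm list \<Rightarrow> nat \<Rightarrow> nat \<Rightarrow> ('p \<times> nat \<times> 'm) list" where
  "resend_list k xs a c = map (\<lambda>i. (k, Suc i, xs ! i)) [a..<c]"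

text \<open>
  The payloads by which a verified string extends a list of \<open>c\<close> messages from sender \<open>k\<close>: labels
  must continue the sequence, and messages that are already in the list are skipped.
\<close>

fun get_messages :: "'p \<Rightarrow> nat \<Rightarrow> ('p \<times> nat \<times> 'm) list \<Rightarrow> 'm list" where
  "get_messages k c [] = []"
| "get_messages k c ((k', l, m) # xs) =
     (if k' = k \<and> l = Suc c then m # get_messages k (Suc c) xs else get_messages k c xs)"

datatype ('p, 'm, 'sig, 'str) action =
    OfBroadcast 'm
  | BcchDeliver 'p nat 'm
  | Receive 'p "('p, 'sig, 'str) msg"
  | VbcDecide nat "('p, 'sig) vbc_value"
  | StartRound
  | HandleStatus 'p nat "'p \<Rightarrow> nat" 'sig
  | Propose
  | HandleDecide
  | HandleMissing 'p nat 'p nat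
  | HandleResend 'p nat 'p 'str
  | FinishRound

fun handler :: "('p, 'm, 'sig, 'str) action \<Rightarrow> bool" where
  "handler (OfBroadcast m) = False"
| "handler (BcchDeliver k l m) = False"
| "handler (Receive q \<mu>) = False"
| "handler (VbcDecide r v) = False"
| "handler _ = True"

definition no_output :: "'p \<Rightarrow> ('p, 'sig, 'str) msg list" where
  "no_output = (\<lambda>_. [])"

text \<open>
  \<open>lstep \<pi> p a s s' out\<close>: process \<open>p\<close> performs \<open>a\<close> and thereby goes from state \<open>s\<close> to \<open>s'\<close>, sending
  the messages \<open>out q\<close> to every process \<open>q\<close>.

  The event \<open>OfBroadcast m\<close> includes the invocation of bcch-broadcast\<open>(m)\<close>, and \<open>Propose\<close> in state
  \<open>s\<close> is the invocation of vbc-propose\<open>(Lmat s, Sigma s)\<close> in the instance of round \<open>rnd s\<close>.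
  Arrived messages and consensus decisions are buffered by \<open>Receive\<close> and \<open>VbcDecide\<close>, and are
  processed once the condition of their handler holds.

  A request for missing messages of round \<open>r'\<close> is answered with respect to the cut of round \<open>r'\<close>,
  also after \<open>p\<close> has proceeded to a later round: otherwise a process that lags behind could never
  obtain messages that a Byzantine sender has withheld from it.
\<close>

inductive lstep ::
  "('p::finite, 'm, 'sig, 'str) params \<Rightarrow> 'p \<Rightarrow> ('p, 'm, 'sig, 'str) action \<Rightarrow>
   ('p, 'm, 'sig, 'str) lstate \<Rightarrow> ('p, 'm, 'sig, 'str) lstate \<Rightarrow>
   ('p \<Rightarrow> ('p, 'sig, 'str) msg list) \<Rightarrow> bool"
  for \<pi> p where
  of_broadcast:
    "lstep \<pi> p (OfBroadcast m) s s no_output"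
| bcch_deliver:
    "lstep \<pi> p (BcchDeliver k l m) s
       (s\<lparr> vc := (vc s)(k := vc s k + 1), msgs := (msgs s)(k := msgs s k @ [m]) \<rparr>) no_output"
| receive:
    "lstep \<pi> p (Receive q \<mu>) s (s\<lparr> inbox := insert (q, \<mu>) (inbox s) \<rparr>) no_output"
| vbc_decide:
    "lstep \<pi> p (VbcDecide r v) s (s\<lparr> decision := (decision s)(r := Some v) \<rparr>) no_output"
| start_round:
    "\<lbrakk> \<not> inround s; \<exists>j. length (msgs s j) > cut s j \<rbrakk> \<Longrightarrow>
     lstep \<pi> p StartRound s (s\<lparr> inround := True \<rparr>)
       (\<lambda>_. [STATUS (rnd s) (vc s) (sign \<pi> p (vc s))])"
| handle_status:
    "\<lbrakk> (q, STATUS r' v' \<sigma>') \<in> inbox s; r' = rnd s; verifysig \<pi> q v' \<sigma>' \<rbrakk> \<Longrightarrow>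
     lstep \<pi> p (HandleStatus q r' v' \<sigma>') s
       (s\<lparr> inbox := inbox s - {(q, STATUS r' v' \<sigma>')},
           Lmat := (Lmat s)(q := v'), Sigma := (Sigma s)(q := Some \<sigma>') \<rparr>) no_output"
| propose:
    "\<lbrakk> card {j. Sigma s j \<noteq> None} \<ge> CARD('p) - faults \<pi> \<rbrakk> \<Longrightarrow>
     lstep \<pi> p Propose s (s\<lparr> Sigma := (\<lambda>_. None) \<rparr>) no_output"
| handle_decide:
    "\<lbrakk> decision s (rnd s) = Some (L', \<Sigma>'); cuts s (rnd s) = None; c = cut_of (faults \<pi>) L';
       distinct js; set js = {j. vc s j < c j} \<rbrakk> \<Longrightarrow>
     lstep \<pi> p HandleDecide s (s\<lparr> cut := c, cuts := (cuts s)(rnd s := Some c) \<rparr>)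
       (\<lambda>_. map (\<lambda>j. MISSING (rnd s) j (vc s j)) js)"
| handle_missing:
    "\<lbrakk> (q, MISSING r' k idx) \<in> inbox s; r' \<le> rnd s; cuts s r' = Some c; vc s k \<ge> c k \<rbrakk> \<Longrightarrow>
     lstep \<pi> p (HandleMissing q r' k idx) s
       (s\<lparr> inbox := inbox s - {(q, MISSING r' k idx)} \<rparr>)
       (no_output(q := [RESEND r' k (create_proof \<pi> (resend_list k (msgs s k) idx (c k)))]))"
| handle_resend:
    "\<lbrakk> (q, RESEND r' k str) \<in> inbox s; r' = rnd s; length (msgs s k) < cut s k;
       new = (if verify_proof \<pi> str
              then get_messages k (length (msgs s k)) (proof_contents \<pi> str) else []) \<rbrakk> \<Longrightarrow>
     lstep \<pi> p (HandleResend q r' k str) s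
       (s\<lparr> inbox := inbox s - {(q, RESEND r' k str)},
           vc := (vc s)(k := vc s k + length new),
           msgs := (msgs s)(k := msgs s k @ new) \<rparr>) no_output"
| finish_round:
    "\<lbrakk> cuts s (rnd s) \<noteq> None; \<forall>j. cut s j \<le> length (msgs s j);
       ls = (\<lambda>j. take (cut s j) (msgs s j));
       V = (\<Union>j. set (ls j)) - delivered s;
       collapsed (payload_graph V (order_edges (faults \<pi>) (kappa \<pi>) ls V)) H;
       deliver_loop (select \<pi>) (stable (faults \<pi>) (kappa \<pi>) ls) H ws \<rbrakk> \<Longrightarrow>
     lstep \<pi> p FinishRound s
       (s\<lparr> olog := olog s @ ws, delivered := delivered s \<union> \<Union> (set ws),
           Lmat := (\<lambda>_ _. 0), inround := False, rnd := rnd s + 1 \<rparr>) no_output"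


section \<open>Executions\<close>

text \<open>
  \<open>st t p\<close> is the state of the correct process \<open>p\<close> at time \<open>t\<close>, \<open>link t q p\<close> the sequence of
  messages in transit from \<open>q\<close> to \<open>p\<close>, and \<open>ev t\<close> the event at time \<open>t\<close>, leading to the
  configuration at time \<open>t + 1\<close>; \<open>None\<close> means that no correct process performs an event.
  Byzantine processes have no state; what they do is visible only through the messages received
  from them and through the primitives.
\<close>

record ('p, 'm, 'sig, 'str) run =
  st :: "nat \<Rightarrow> 'p \<Rightarrow> ('p, 'm, 'sig, 'str) lstate"
  link :: "nat \<Rightarrow> 'p \<Rightarrow> 'p \<Rightarrow> ('p, 'sig, 'str) msg list"
  ev :: "nat \<Rightarrow> ('p \<times> ('p, 'm, 'sig, 'str) action) option"

definition in_transit ::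
  "'p set \<Rightarrow> 'p \<Rightarrow> ('p, 'm, 'sig, 'str) action \<Rightarrow> ('p \<Rightarrow> 'p \<Rightarrow> ('p, 'sig, 'str) msg list) \<Rightarrow>
   'p \<Rightarrow> 'p \<Rightarrow> ('p, 'sig, 'str) msg list" where
  "in_transit Cor p a lk = (case a of
       Receive q \<mu> \<Rightarrow>
         (\<lambda>x y. if x = q \<and> y = p \<and> q \<in> Cor then tl (lk x y) else lk x y)
     | _ \<Rightarrow> lk)"

text \<open>Links are authenticated FIFO queues: what arrives from a correct process is the head of the
  queue, whereas anything may arrive from a Byzantine process.\<close>

definition protocol_run ::
  "('p::finite, 'm, 'sig, 'str) params \<Rightarrow> 'p set \<Rightarrow> ('p, 'm, 'sig, 'str) run \<Rightarrow> bool" where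
  "protocol_run \<pi> Cor \<rho> \<longleftrightarrow>
     (\<forall>p\<in>Cor. st \<rho> 0 p = init_state) \<and>
     (\<forall>p q. link \<rho> 0 p q = []) \<and>
     (\<forall>t. case ev \<rho> t of
        None \<Rightarrow> st \<rho> (Suc t) = st \<rho> t \<and> link \<rho> (Suc t) = link \<rho> t
      | Some (p, a) \<Rightarrow>
          p \<in> Cor \<and>
          (\<forall>q \<mu>. a = Receive q \<mu> \<and> q \<in> Cor \<longrightarrow> link \<rho> t q p \<noteq> [] \<and> hd (link \<rho> t q p) = \<mu>) \<and>
          (\<exists>s' out. lstep \<pi> p a (st \<rho> t p) s' out \<and>
             st \<rho> (Suc t) = (st \<rho> t)(p := s') \<and>
             link \<rho> (Suc t) =
               (\<lambda>x y. in_transit Cor p a (link \<rho> t) x y @ (if x = p then out y else []))))"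

text \<open>Links between correct processes are reliable, and a correct process eventually executes
  every handler whose condition holds from some time on.\<close>

definition fair_run ::
  "('p::finite, 'm, 'sig, 'str) params \<Rightarrow> 'p set \<Rightarrow> ('p, 'm, 'sig, 'str) run \<Rightarrow> bool" where
  "fair_run \<pi> Cor \<rho> \<longleftrightarrow>
     (\<forall>p\<in>Cor. \<forall>q\<in>Cor. \<forall>t. link \<rho> t q p \<noteq> [] \<longrightarrow>
        (\<exists>t'\<ge>t. \<exists>\<mu>. ev \<rho> t' = Some (p, Receive q \<mu>))) \<and>
     (\<forall>p\<in>Cor. \<forall>a T. handler a \<and> (\<forall>t\<ge>T. \<exists>s' out. lstep \<pi> p a (st \<rho> t p) s' out) \<longrightarrow>
        (\<exists>t\<ge>T. ev \<rho> t = Some (p, a)))"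

definition of_bcast :: "('p, 'm, 'sig, 'str) run \<Rightarrow> nat \<Rightarrow> 'p \<Rightarrow> 'm \<Rightarrow> bool" where
  "of_bcast \<rho> t p m \<longleftrightarrow> ev \<rho> t = Some (p, OfBroadcast m)"

definition of_log :: "('p, 'm, 'sig, 'str) run \<Rightarrow> nat \<Rightarrow> 'p \<Rightarrow> 'm set list" where
  "of_log \<rho> t p = olog (st \<rho> t p)"

text \<open>Perfect unforgeability: a valid signature of a correct process that shows up in a message or
  in a decision has been generated by this process before.\<close>

definition signed_before ::
  "('p, 'm, 'sig, 'str) run \<Rightarrow> nat \<Rightarrow> 'p \<Rightarrow> ('p \<Rightarrow> nat) \<Rightarrow> bool" where
  "signed_before \<rho> t j v \<longleftrightarrow> (\<exists>t'<t. ev \<rho> t' = Some (j, StartRound) \<and> vc (st \<rho> t' j) = v)"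

definition signatures_secure ::
  "('p, 'm, 'sig, 'str) params \<Rightarrow> 'p set \<Rightarrow> ('p, 'm, 'sig, 'str) run \<Rightarrow> bool" where
  "signatures_secure \<pi> Cor \<rho> \<longleftrightarrow>
     (\<forall>t p q r v \<sigma>. ev \<rho> t = Some (p, Receive q (STATUS r v \<sigma>)) \<longrightarrow>
        (\<forall>j\<in>Cor. verifysig \<pi> j v \<sigma> \<longrightarrow> signed_before \<rho> t j v)) \<and>
     (\<forall>t p r L' \<Sigma>'. ev \<rho> t = Some (p, VbcDecide r (L', \<Sigma>')) \<longrightarrow>
        (\<forall>j\<in>Cor. \<forall>\<sigma>. \<Sigma>' j = Some \<sigma> \<and> verifysig \<pi> j (L' j) \<sigma> \<longrightarrow> signed_before \<rho> t j (L' j)))"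

text \<open>
  The broadcast channel. The messages that \<open>p\<close> has delivered from sender \<open>k\<close> are those in
  \<open>msgs[k]\<close>, including the ones obtained by verifiable transfer: the channel does not deliver a
  message again that has been transferred. Only one instance per sender is active at a time;
  hence the next message that \<open>p\<close> delivers from \<open>k\<close> has the next sequence number as its label.
\<close>

definition bcch_sequenced :: "('p, 'm, 'sig, 'str) run \<Rightarrow> bool" where
  "bcch_sequenced \<rho> \<longleftrightarrow>
     (\<forall>t p k l m. ev \<rho> t = Some (p, BcchDeliver k l m) \<longrightarrow> l = length (msgs (st \<rho> t p) k) + 1)"

definition bcch_validity :: "'p set \<Rightarrow> ('p, 'm, 'sig, 'str) run \<Rightarrow> bool" where
  "bcch_validity Cor \<rho> \<longleftrightarrow>
     (\<forall>k\<in>Cor. \<forall>t m. of_bcast \<rho> t k m \<longrightarrow> (\<forall>p\<in>Cor. \<exists>t'. m \<in> set (msgs (st \<rho> t' p) k)))"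

definition bcch_no_duplication :: "'p set \<Rightarrow> ('p, 'm, 'sig, 'str) run \<Rightarrow> bool" where
  "bcch_no_duplication Cor \<rho> \<longleftrightarrow>
     (\<forall>p\<in>Cor. \<forall>k l m m' t t'. ev \<rho> t = Some (p, BcchDeliver k l m) \<and>
        ev \<rho> t' = Some (p, BcchDeliver k l m') \<longrightarrow> t = t')"

definition bcch_integrity :: "'p set \<Rightarrow> ('p, 'm, 'sig, 'str) run \<Rightarrow> bool" where
  "bcch_integrity Cor \<rho> \<longleftrightarrow>
     (\<forall>p\<in>Cor. \<forall>k\<in>Cor. \<forall>t l m. ev \<rho> t = Some (p, BcchDeliver k l m) \<longrightarrow>
        (\<exists>t'<t. of_bcast \<rho> t' k m))"

definition bcch_consistency :: "'p set \<Rightarrow> ('p, 'm, 'sig, 'str) run \<Rightarrow> bool" where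
  "bcch_consistency Cor \<rho> \<longleftrightarrow>
     (\<forall>p\<in>Cor. \<forall>q\<in>Cor. \<forall>k l m m' t t'. ev \<rho> t = Some (p, BcchDeliver k l m) \<and>
        ev \<rho> t' = Some (q, BcchDeliver k l m') \<longrightarrow> m = m')"

definition bcch_fifo :: "'p set \<Rightarrow> ('p, 'm, 'sig, 'str) run \<Rightarrow> bool" where
  "bcch_fifo Cor \<rho> \<longleftrightarrow>
     (\<forall>p\<in>Cor. \<forall>k\<in>Cor. \<forall>t l m m'. bc_before (of_bcast \<rho>) k m m' \<and>
        ev \<rho> t = Some (p, BcchDeliver k l m') \<longrightarrow> m \<in> set (msgs (st \<rho> t p) k))"

definition bcch_unforgeable ::
  "('p, 'm, 'sig, 'str) params \<Rightarrow> 'p set \<Rightarrow> ('p, 'm, 'sig, 'str) run \<Rightarrow> bool" where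
  "bcch_unforgeable \<pi> Cor \<rho> \<longleftrightarrow>
     (\<forall>t p q r j str. ev \<rho> t = Some (p, Receive q (RESEND r j str)) \<and> verify_proof \<pi> str \<longrightarrow>
        (\<forall>(k, l, m) \<in> set (proof_contents \<pi> str).
           \<exists>t'<t. \<exists>p'\<in>Cor. ev \<rho> t' = Some (p', BcchDeliver k l m)))"

definition bcch_channel ::
  "('p, 'm, 'sig, 'str) params \<Rightarrow> 'p set \<Rightarrow> ('p, 'm, 'sig, 'str) run \<Rightarrow> bool" where
  "bcch_channel \<pi> Cor \<rho> \<longleftrightarrow>
     bcch_sequenced \<rho> \<and> bcch_validity Cor \<rho> \<and> bcch_no_duplication Cor \<rho> \<and>
     bcch_integrity Cor \<rho> \<and> bcch_consistency Cor \<rho> \<and> bcch_fifo Cor \<rho> \<and>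
     bcch_unforgeable \<pi> Cor \<rho>"

definition vbc_proposes ::
  "('p, 'm, 'sig, 'str) run \<Rightarrow> nat \<Rightarrow> 'p \<Rightarrow> nat \<Rightarrow> ('p, 'sig) vbc_value \<Rightarrow> bool" where
  "vbc_proposes \<rho> t p r v \<longleftrightarrow>
     ev \<rho> t = Some (p, Propose) \<and> r = rnd (st \<rho> t p) \<and> v = (Lmat (st \<rho> t p), Sigma (st \<rho> t p))"

definition vbc_decides ::
  "('p, 'm, 'sig, 'str) run \<Rightarrow> nat \<Rightarrow> 'p \<Rightarrow> nat \<Rightarrow> ('p, 'sig) vbc_value \<Rightarrow> bool" where
  "vbc_decides \<rho> t p r v \<longleftrightarrow> ev \<rho> t = Some (p, VbcDecide r v)"

text \<open>Termination concerns every instance in which some correct process takes part.\<close>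

definition vbc_termination :: "'p set \<Rightarrow> ('p, 'm, 'sig, 'str) run \<Rightarrow> bool" where
  "vbc_termination Cor \<rho> \<longleftrightarrow>
     (\<forall>r. (\<exists>p\<in>Cor. \<exists>t v. vbc_proposes \<rho> t p r v \<or> vbc_decides \<rho> t p r v) \<longrightarrow>
        (\<forall>p\<in>Cor. \<exists>t v. vbc_decides \<rho> t p r v))"

definition vbc_integrity :: "'p set \<Rightarrow> ('p, 'm, 'sig, 'str) run \<Rightarrow> bool" where
  "vbc_integrity Cor \<rho> \<longleftrightarrow>
     (\<forall>p\<in>Cor. \<forall>r t t' v v'. vbc_decides \<rho> t p r v \<and> vbc_decides \<rho> t' p r v' \<longrightarrow> t = t')"

definition vbc_agreement :: "'p set \<Rightarrow> ('p, 'm, 'sig, 'str) run \<Rightarrow> bool" where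
  "vbc_agreement Cor \<rho> \<longleftrightarrow>
     (\<forall>p\<in>Cor. \<forall>q\<in>Cor. \<forall>r t t' v v'.
        vbc_decides \<rho> t p r v \<and> vbc_decides \<rho> t' q r v' \<longrightarrow> v = v')"

text \<open>As usual for Byzantine consensus with weak validity, if all processes are correct, then only
  proposed values are decided; in particular a unanimous proposal is decided.\<close>

definition vbc_external_validity ::
  "('p::finite, 'm, 'sig, 'str) params \<Rightarrow> 'p set \<Rightarrow> ('p, 'm, 'sig, 'str) run \<Rightarrow> bool" where
  "vbc_external_validity \<pi> Cor \<rho> \<longleftrightarrow>
     (\<forall>p\<in>Cor. \<forall>t r v. vbc_decides \<rho> t p r v \<longrightarrow> vbc_predicate \<pi> v) \<and>
     (Cor = UNIV \<longrightarrow>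
        (\<forall>p t r v v'. (\<forall>q. \<exists>t'. vbc_proposes \<rho> t' q r v) \<and> vbc_decides \<rho> t p r v' \<longrightarrow> v' = v) \<and>
        (\<forall>p t r v. vbc_decides \<rho> t p r v \<longrightarrow> (\<exists>t'<t. \<exists>q. vbc_proposes \<rho> t' q r v)))"

definition validated_consensus ::
  "('p::finite, 'm, 'sig, 'str) params \<Rightarrow> 'p set \<Rightarrow> ('p, 'm, 'sig, 'str) run \<Rightarrow> bool" where
  "validated_consensus \<pi> Cor \<rho> \<longleftrightarrow>
     vbc_termination Cor \<rho> \<and> vbc_integrity Cor \<rho> \<and> vbc_agreement Cor \<rho> \<and>
     vbc_external_validity \<pi> Cor \<rho>"

end

theory Submission
  imports Defs "HOL-Library.Disjoint_Sets" "HOL-Library.Sublist"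
begin

text \<open>
  Consistency of the broadcast channel makes the messages of every sender a single global sequence,
  and consensus fixes the cut of every round, so the graph of a round is the same at all correct
  processes. Its collapse is the graph of strongly connected components, and the delivery loop is
  deterministic; hence the log at the beginning of round \<open>r\<close> is a function of \<open>r\<close>. This gives total
  order and no duplication. Agreement follows because a process that has finished a round can resend
  every message up to the cut of this round.

  For fairness, suppose that \<open>b(m, m') > b(m', m) + 2f + \<kappa>\<close> and that \<open>m'\<close> is delivered in some round.
  As \<open>m'\<close> is stable, FIFO delivery puts \<open>m\<close> below the cut too, and counting shows that the graph has
  an edge from \<open>m\<close> to \<open>m'\<close>, so that \<open>m\<close> is delivered no later than \<open>m'\<close>.

  For weak validity, either there are infinitely many rounds, and a sufficiently late one has a cut
  above all payloads, or the processes get stuck in some round. In the latter case no consensus value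
  is decided in this round, so some process has no reason to start it, and already the cut of the
  previous round is above all payloads.
\<close>

section \<open>Collapsed graphs and the delivery loop\<close>

text \<open>The invariant of collapsing. Since an acyclic graph with this property is unique, the outcome
  does not depend on the order in which strongly connected subgraphs are contracted.\<close>

definition quotient_graph :: "'m set \<Rightarrow> ('m \<times> 'm) set \<Rightarrow> 'm graph \<Rightarrow> bool" where
  "quotient_graph V E G \<longleftrightarrow>
     partition_on V (fst G) \<and>
     snd G = {(A, B). A \<in> fst G \<and> B \<in> fst G \<and> A \<noteq> B \<and> (\<exists>a\<in>A. \<exists>b\<in>B. (a, b) \<in> E)} \<and>
     (\<forall>A\<in>fst G. \<forall>a\<in>A. \<forall>b\<in>A. (a, b) \<in> E\<^sup>*)"

lemma quotient_graph_payload_graph: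
  assumes "E \<subseteq> V \<times> V" "irrefl E"
  shows "quotient_graph V E (payload_graph V E)"
proof -
  have "snd (payload_graph V E) = {(A, B). A \<in> (\<lambda>m. {m}) ` V \<and> B \<in> (\<lambda>m. {m}) ` V \<and> A \<noteq> B \<and>
      (\<exists>a\<in>A. \<exists>b\<in>B. (a, b) \<in> E)}"
    using assms unfolding payload_graph_def irrefl_def by force
  moreover have "partition_on V ((\<lambda>m. {m}) ` V)"
    by (auto simp: partition_on_def disjoint_def)
  ultimately show ?thesis unfolding quotient_graph_def by (auto simp: payload_graph_def)
qed

lemma quotient_graphD:
  assumes "quotient_graph V E G"
  shows "partition_on V (fst G)" "\<Union> (fst G) = V" "{} \<notin> fst G"
    and "A \<in> fst G \<Longrightarrow> B \<in> fst G \<Longrightarrow> x \<in> A \<Longrightarrow> x \<in> B \<Longrightarrow> A = B"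
    and "(A, B) \<in> snd G \<longleftrightarrow>
      A \<in> fst G \<and> B \<in> fst G \<and> A \<noteq> B \<and> (\<exists>a\<in>A. \<exists>b\<in>B. (a, b) \<in> E)"
    and "snd G \<subseteq> fst G \<times> fst G"
    and "A \<in> fst G \<Longrightarrow> x \<in> A \<Longrightarrow> y \<in> A \<Longrightarrow> (x, y) \<in> E\<^sup>*"
  using assms unfolding quotient_graph_def partition_on_def disjoint_def by auto

text \<open>Every edge between blocks is witnessed by an edge of \<open>E\<close>. The endpoint at
  which a block is entered and the one at which it is left may differ, but the block invariant joins
  them by an \<open>E\<close>-path.\<close>

lemma quotient_graph_path_lift:
  assumes G: "quotient_graph V E G" and "(A, B) \<in> (snd G)\<^sup>*" "A \<in> fst G" "a \<in> A" "b \<in> B"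
  shows "(a, b) \<in> E\<^sup>*"
  using assms(2,5)
proof (induction arbitrary: b rule: rtrancl_induct)
  case base
  then show ?case using quotient_graphD(7)[OF G] assms(3,4) by blast
next
  case (step B C)
  then obtain x y where xy: "x \<in> B" "y \<in> C" "(x, y) \<in> E" "C \<in> fst G"
    using quotient_graphD(5)[OF G] by blast
  then have "(y, b) \<in> E\<^sup>*"
    using quotient_graphD(7)[OF G] step.prems by blast
  then show ?case using step.IH[OF xy(1)] xy(3) by (meson rtrancl.rtrancl_into_rtrancl rtrancl_trans)
qed

text \<open>Each single step of \<open>E\<close> either stays inside a block or is an edge between
  two blocks.\<close>

lemma quotient_graph_path_proj:
  assumes G: "quotient_graph V E G" and "E \<subseteq> V \<times> V" and "(a, b) \<in> E\<^sup>*"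
    and "A \<in> fst G" "a \<in> A" "B \<in> fst G" "b \<in> B"
  shows "(A, B) \<in> (snd G)\<^sup>*"
  using assms(3,6,7)
proof (induction arbitrary: B rule: rtrancl_induct)
  case base
  then have "A = B" using quotient_graphD(4)[OF G] assms(4,5) by blast
  then show ?case by simp
next
  case (step y z)
  then obtain Y where Y: "Y \<in> fst G" "y \<in> Y"
    using assms(2) quotient_graphD(2)[OF G] by blast
  show ?case
  proof (cases "Y = B")
    case True then show ?thesis using step Y by blast
  next
    case False
    then have "(Y, B) \<in> snd G"
      using Y step.prems step.hyps quotient_graphD(5)[OF G] by blast
    then show ?thesis using step.IH[OF Y] by simp
  qed
qed

text \<open>Only the merged block \<open>\<Union> S\<close> is new. Its members reach each other
  because the paths between vertices of \<open>S\<close> lift to \<open>E\<close>; the edges of the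
  contracted graph are still exactly those witnessed by \<open>E\<close>.\<close>

lemma quotient_graph_contract:
  assumes G: "quotient_graph V E G" and S: "S \<subseteq> fst G" "S \<noteq> {}"
    and conn: "\<forall>a\<in>S. \<forall>b\<in>S. (a, b) \<in> (snd G \<inter> S \<times> S)\<^sup>*"
  shows "quotient_graph V E (contract S G)"
proof -
  define \<phi> where "\<phi> = (\<lambda>w. if w \<in> S then \<Union> S else w)"
  have fst_c: "fst (contract S G) = \<phi> ` fst G"
    and snd_c: "snd (contract S G) = {(\<phi> a, \<phi> b) | a b. (a, b) \<in> snd G \<and> \<phi> a \<noteq> \<phi> b}"
    unfolding contract_def \<phi>_def by (simp_all add: Let_def)
  have part: "partition_on V (fst G)"
    and edges: "snd G = {(A, B). A \<in> fst G \<and> B \<in> fst G \<and> A \<noteq> B \<and> (\<exists>a\<in>A. \<exists>b\<in>B. (a, b) \<in> E)}"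
    using G unfolding quotient_graph_def by auto
  note disj = quotient_graphD(4)[OF G]
  have img: "\<phi> ` fst G = insert (\<Union> S) (fst G - S)"
    using S unfolding \<phi>_def by auto
  have sub: "a \<subseteq> \<phi> a" for a unfolding \<phi>_def by auto
  have "partition_on V (\<phi> ` fst G)"
  proof (rule partition_onI)
    show "\<Union> (\<phi> ` fst G) = V"
      unfolding img using part S unfolding partition_on_def by auto
  next
    have "\<phi> a \<noteq> {}" if "a \<in> fst G" for a
      using quotient_graphD(3)[OF G] that sub[of a] by auto
    then show "{} \<notin> \<phi> ` fst G" by auto
  next
    fix p q assume "p \<in> \<phi> ` fst G" "q \<in> \<phi> ` fst G" "p \<noteq> q"
    then show "disjnt p q" using disj S unfolding img disjnt_def by blast
  qed
  moreover have "snd (contract S G) =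
      {(A, B). A \<in> \<phi> ` fst G \<and> B \<in> \<phi> ` fst G \<and> A \<noteq> B \<and> (\<exists>a\<in>A. \<exists>b\<in>B. (a, b) \<in> E)}"
  proof -
    have lift: "\<exists>a\<in>fst G. x \<in> a \<and> \<phi> a = A" if "A \<in> \<phi> ` fst G" "x \<in> A" for A x
      using that S unfolding \<phi>_def by (auto split: if_splits)
    show ?thesis
    proof (intro equalityI subsetI)
      fix e assume "e \<in> snd (contract S G)"
      then obtain a b where "e = (\<phi> a, \<phi> b)" "(a, b) \<in> snd G" "\<phi> a \<noteq> \<phi> b"
        unfolding snd_c by blast
      then show "e \<in> {(A, B). A \<in> \<phi> ` fst G \<and> B \<in> \<phi> ` fst G \<and> A \<noteq> B \<and> (\<exists>a\<in>A. \<exists>b\<in>B. (a, b) \<in> E)}"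
        unfolding edges using sub[of a] sub[of b] by blast
    next
      fix e assume "e \<in> {(A, B). A \<in> \<phi> ` fst G \<and> B \<in> \<phi> ` fst G \<and> A \<noteq> B \<and> (\<exists>a\<in>A. \<exists>b\<in>B. (a, b) \<in> E)}"
      then obtain A B x y where e: "e = (A, B)" "A \<in> \<phi> ` fst G" "B \<in> \<phi> ` fst G" "A \<noteq> B"
        "x \<in> A" "y \<in> B" "(x, y) \<in> E" by blast
      obtain a where a: "a \<in> fst G" "x \<in> a" "\<phi> a = A" using lift[OF e(2,5)] by blast
      obtain b where b: "b \<in> fst G" "y \<in> b" "\<phi> b = B" using lift[OF e(3,6)] by blast
      have "(a, b) \<in> snd G" unfolding edges using a b e by auto
      then show "e \<in> snd (contract S G)" unfolding snd_c using a b e by blast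
    qed
  qed
  moreover have "(x, y) \<in> E\<^sup>*" if A: "A \<in> \<phi> ` fst G" "x \<in> A" "y \<in> A" for A x y
  proof (cases "A = \<Union> S")
    case True
    then obtain X Y where XY: "X \<in> S" "x \<in> X" "Y \<in> S" "y \<in> Y" using A by blast
    have "(snd G \<inter> S \<times> S)\<^sup>* \<subseteq> (snd G)\<^sup>*" by (intro rtrancl_mono) auto
    then have "(X, Y) \<in> (snd G)\<^sup>*" using conn XY by blast
    then show ?thesis using quotient_graph_path_lift[OF G _ _ XY(2,4)] XY(1) S by blast
  next
    case False
    then have "A \<in> fst G" using A(1) unfolding img by simp
    then show ?thesis using quotient_graphD(7)[OF G] A by blast
  qed
  then have "\<forall>A\<in>\<phi> ` fst G. \<forall>a\<in>A. \<forall>b\<in>A. (a, b) \<in> E\<^sup>*" by blast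
  ultimately show ?thesis unfolding quotient_graph_def fst_c by - (intro conjI)
qed

lemma quotient_graph_collapse_steps:
  assumes "collapse_step\<^sup>*\<^sup>* G H" "quotient_graph V E G"
  shows "quotient_graph V E H"
  using assms
proof (induction rule: rtranclp_induct)
  case (step G' H')
  from step.hyps(2) show ?case
  proof cases
    case (1 S)
    then show ?thesis using quotient_graph_contract[of V E G' S] step by fastforce
  qed
qed simp

text \<open>In an acyclic quotient, mutually reachable payloads share a block, since their blocks
  reach each other and reachability is antisymmetric; the converse is the invariant. So the blocks
  are the strongly connected components of \<open>E\<close>, and the blocks determine the
  edges.\<close>

lemma acyclic_quotient_graph_unique:
  assumes E: "E \<subseteq> V \<times> V"
    and G: "quotient_graph V E G" "acyclic (snd G)"
    and H: "quotient_graph V E H" "acyclic (snd H)"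
  shows "G = H"
proof -
  have same: "b \<in> A"
    if Q: "quotient_graph V E Q" "acyclic (snd Q)" and A: "A \<in> fst Q" "a \<in> A" and b: "b \<in> V"
      and ab: "(a, b) \<in> E\<^sup>*" "(b, a) \<in> E\<^sup>*" for Q A a b
  proof -
    obtain B where B: "B \<in> fst Q" "b \<in> B"
      using quotient_graphD(2)[OF Q(1)] b by blast
    have "(A, B) \<in> (snd Q)\<^sup>*" "(B, A) \<in> (snd Q)\<^sup>*"
      using quotient_graph_path_proj[OF Q(1) E] ab A B by blast+
    then have "A = B" using Q(2) acyclic_impl_antisym_rtrancl[of "snd Q"]
      unfolding antisym_def by blast
    then show ?thesis using B by simp
  qed
  have sub: "fst P \<subseteq> fst Q"
    if P: "quotient_graph V E P" "acyclic (snd P)" and Q: "quotient_graph V E Q" "acyclic (snd Q)"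
    for P Q
  proof
    fix A assume A: "A \<in> fst P"
    then have "A \<noteq> {}" using quotient_graphD(3)[OF P(1)] by auto
    then obtain a where a: "a \<in> A" "a \<in> V" using quotient_graphD(2)[OF P(1)] A by blast
    then obtain B where B: "B \<in> fst Q" "a \<in> B"
      using quotient_graphD(2)[OF Q(1)] by blast
    have "A \<subseteq> B"
    proof
      fix b assume b: "b \<in> A"
      then have "b \<in> V" "(a, b) \<in> E\<^sup>*" "(b, a) \<in> E\<^sup>*"
        using quotient_graphD(2,7)[OF P(1)] A a by blast+
      then show "b \<in> B" using same[OF Q B] by blast
    qed
    moreover have "B \<subseteq> A"
    proof
      fix b assume b: "b \<in> B"
      then have "b \<in> V" "(a, b) \<in> E\<^sup>*" "(b, a) \<in> E\<^sup>*"
        using quotient_graphD(2,7)[OF Q(1)] B by blast+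
      then show "b \<in> A" using same[OF P A a(1)] by blast
    qed
    ultimately show "A \<in> fst Q" using B by simp
  qed
  have "fst G = fst H" using sub[OF G H] sub[OF H G] by blast
  moreover from this have "snd G = snd H" using G H unfolding quotient_graph_def by auto
  ultimately show ?thesis by (simp add: prod_eq_iff)
qed

lemma quotient_graph_finite:
  assumes "quotient_graph V E G" "finite V"
  shows "finite (fst G)" "finite (snd G)"
proof -
  show *: "finite (fst G)"
    using finite_elements[OF assms(2) quotient_graphD(1)[OF assms(1)]] .
  then show "finite (snd G)" using quotient_graphD(6)[OF assms(1)] finite_subset by blast
qed

text \<open>The set to contract is the whole strongly connected component of a vertex on a cycle. It
  has two members because a quotient graph has no loops.\<close>

lemma cyclic_quotient_graph_collapse_step:
  assumes G: "quotient_graph V E G" and fin: "finite V" and cyc: "\<not> acyclic (snd G)"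
  shows "\<exists>H. collapse_step G H \<and> card (fst H) < card (fst G)"
proof -
  obtain A where A: "(A, A) \<in> (snd G)\<^sup>+" using cyc unfolding acyclic_def by blast
  define S where "S = {X. (A, X) \<in> (snd G)\<^sup>* \<and> (X, A) \<in> (snd G)\<^sup>*}"
  have edges: "snd G \<subseteq> fst G \<times> fst G" "irrefl (snd G)"
    using quotient_graphD(5,6)[OF G] unfolding irrefl_def by auto
  obtain B where B: "(A, B) \<in> snd G" "(B, A) \<in> (snd G)\<^sup>*"
    using A by (meson tranclD)
  have AB: "A \<in> S" "B \<in> S" "A \<noteq> B" using B edges(2) unfolding S_def irrefl_def by auto
  have sub: "S \<subseteq> fst G"
  proof
    fix X assume "X \<in> S"
    then have "(A, X) \<in> (snd G)\<^sup>*" unfolding S_def by simp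
    then show "X \<in> fst G"
      by (induction rule: rtrancl_induct) (use B(1) edges(1) in auto)
  qed
  have finG: "finite (fst G)" using quotient_graph_finite[OF G fin] by blast
  have "card {A, B} \<le> card S" using AB sub finG by (intro card_mono) (auto intro: finite_subset)
  then have card: "card S \<ge> 2" using AB by simp
  \<comment> \<open>A collapse step demands paths that stay inside \<open>S\<close>. A component
    provides them: every vertex on a path between two members is itself a member.\<close>
  have "(X, Y) \<in> (snd G \<inter> S \<times> S)\<^sup>*" if "X \<in> S" "Y \<in> S" for X Y
  proof -
    have "(X, Y) \<in> (snd G)\<^sup>*" using that unfolding S_def by auto
    then show ?thesis using that(1)
    proof (induction rule: converse_rtrancl_induct)
      case (step X Z)
      have "(A, Z) \<in> (snd G)\<^sup>*" using step unfolding S_def by auto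
      moreover have "(Z, A) \<in> (snd G)\<^sup>*"
        using step.hyps(2) that(2) unfolding S_def by auto
      ultimately have "Z \<in> S" unfolding S_def by simp
      then show ?case using step by (simp add: converse_rtrancl_into_rtrancl)
    qed simp
  qed
  then have "collapse_step G (contract S G)" using sub card by (intro collapse_step.intros) auto
  moreover have "card (fst (contract S G)) < card (fst G)"
  proof -
    define \<phi> where "\<phi> = (\<lambda>w. if w \<in> S then \<Union> S else w)"
    have "\<phi> A = \<phi> B" using AB unfolding \<phi>_def by simp
    then have "\<not> inj_on \<phi> (fst G)" using AB sub unfolding inj_on_def by blast
    then have "card (\<phi> ` fst G) < card (fst G)"
      using finG by (metis card_image_le eq_card_imp_inj_on le_neq_implies_less)
    then show ?thesis unfolding contract_def \<phi>_def by (simp add: Let_def)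
  qed
  ultimately show ?thesis by blast
qed

lemma quotient_graph_collapsed_exists:
  assumes "quotient_graph V E G" "finite V"
  shows "\<exists>H. collapsed G H"
  using assms(1)
proof (induction "card (fst G)" arbitrary: G rule: less_induct)
  case less
  show ?case
  proof (cases "acyclic (snd G)")
    case True then show ?thesis unfolding collapsed_def by blast
  next
    case False
    then obtain G' where G': "collapse_step G G'" "card (fst G') < card (fst G)"
      using cyclic_quotient_graph_collapse_step[OF less.prems assms(2)] by blast
    moreover have "quotient_graph V E G'"
      using quotient_graph_collapse_steps less.prems G'(1) by blast
    ultimately obtain H where "collapsed G' H" using less.hyps by blast
    then show ?thesis using G'(1) unfolding collapsed_def
      by (meson converse_rtranclp_into_rtranclp)
  qed
qed

section \<open>The delivery loop\<close>

context
  fixes sel :: "'m set set \<Rightarrow> 'm set" and stb :: "'m set \<Rightarrow> bool"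
  assumes sel: "\<And>X. X \<noteq> {} \<Longrightarrow> sel X \<in> X"
begin

lemma deliver_loop_exists: "finite (fst G) \<Longrightarrow> \<exists>ws. deliver_loop sel stb G ws"
proof (induction "card (fst G)" arbitrary: G rule: less_induct)
  case less
  show ?case
  proof (cases "deliverable stb G = {}")
    case True then show ?thesis by (auto intro: deliver_loop.stop)
  next
    case False
    define w where "w = sel (deliverable stb G)"
    have "w \<in> fst G" using sel[OF False] unfolding w_def deliverable_def by auto
    then have "card (fst (remove_vertex w G)) < card (fst G)"
      using less.prems card_Diff1_less unfolding remove_vertex_def by fastforce
    then obtain ws where "deliver_loop sel stb (remove_vertex w G) ws"
      using less by (fastforce simp: remove_vertex_def)
    then show ?thesis using False w_def deliver_loop.take by blast
  qed
qed

lemma deliver_loop_unique: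
  "deliver_loop sel stb G ws \<Longrightarrow> deliver_loop sel stb G ws' \<Longrightarrow> ws = ws'"
proof (induction arbitrary: ws' rule: deliver_loop.induct)
  case (stop G)
  from stop(2,1) show ?case by cases simp_all
next
  case (take G w ws)
  note outer = take.IH take.hyps
  from take.prems show ?case
  proof cases
    case stop
    then show ?thesis using outer(2) by simp
  next
    case (take v vs)
    then show ?thesis using outer(1,3) by simp
  qed
qed

lemma deliver_loop_vertices:
  "deliver_loop sel stb G ws \<Longrightarrow> set ws \<subseteq> fst G \<and> (\<forall>w\<in>set ws. stb w) \<and> distinct ws"
proof (induction rule: deliver_loop.induct)
  case (take G w ws)
  have "w \<in> deliverable stb G" using sel take(1,2) by blast
  then show ?case using take.IH unfolding remove_vertex_def deliverable_def by auto
qed simp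

text \<open>A vertex is taken only when nothing points to it, and an edge disappears only with one
  of its ends. So the source of an edge must be gone before its target is taken.\<close>

lemma deliver_loop_order:
  "deliver_loop sel stb G ws \<Longrightarrow> i < length ws \<Longrightarrow> (u, ws ! i) \<in> snd G \<Longrightarrow> \<exists>j<i. ws ! j = u"
proof (induction arbitrary: i rule: deliver_loop.induct)
  case (take G w ws)
  have w: "w \<in> deliverable stb G" using sel take(1,2) by blast
  show ?case
  proof (cases i)
    case 0 then show ?thesis using w take.prems unfolding deliverable_def by auto
  next
    case (Suc i')
    show ?thesis
    proof (cases "u = w")
      case True then show ?thesis using Suc by (intro exI[of _ 0]) simp
    next
      case False
      have i': "i' < length ws" using take.prems Suc by simp
      \<comment> \<open>Hence \<open>ws ! i'\<close> differs from \<open>w\<close>, and the edge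
        survives the removal of \<open>w\<close>.\<close>
      have "ws ! i' \<in> fst (remove_vertex w G)"
        using deliver_loop_vertices[OF take(3)] nth_mem[OF i'] by blast
      then have "(u, ws ! i') \<in> snd (remove_vertex w G)"
        using False take.prems Suc unfolding remove_vertex_def by auto
      then obtain j where "j < i'" "ws ! j = u" using take.IH i' by blast
      then show ?thesis using Suc by (intro exI[of _ "Suc j"]) simp
    qed
  qed
qed simp

text \<open>With all vertices stable the loop can stop only if no vertex is without incoming edges,
  and a finite nonempty acyclic graph always has such a vertex.\<close>

lemma deliver_loop_complete:
  "deliver_loop sel stb G ws \<Longrightarrow> finite (snd G) \<Longrightarrow> acyclic (snd G) \<Longrightarrow> \<forall>w\<in>fst G. stb w \<Longrightarrow>
   snd G \<subseteq> fst G \<times> fst G \<Longrightarrow> fst G \<subseteq> set ws"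
proof (induction rule: deliver_loop.induct)
  case (stop G)
  have "fst G = {}"
  proof (rule ccontr)
    assume "fst G \<noteq> {}"
    moreover have "wf (snd G)" using stop.prems finite_acyclic_wf by blast
    ultimately obtain z where "z \<in> fst G" "\<forall>y. (y, z) \<in> snd G \<longrightarrow> y \<notin> fst G"
      by (metis wfE_min ex_in_conv)
    then show False using stop unfolding deliverable_def by blast
  qed
  then show ?case by simp
next
  case (take G w ws)
  have "snd (remove_vertex w G) \<subseteq> snd G" unfolding remove_vertex_def by auto
  then have "fst (remove_vertex w G) \<subseteq> set ws"
    using take.prems
    by (intro take.IH) (auto simp: remove_vertex_def intro: finite_subset acyclic_subset)
  then show ?case unfolding remove_vertex_def by auto
qed

end

text \<open>The output of a round as a relation on lists and payloads alone, detached from any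
  process state, so that uniqueness of \<open>ws\<close> can be compared across processes.\<close>

definition round_batch ::
  "nat \<Rightarrow> real \<Rightarrow> ('m set set \<Rightarrow> 'm set) \<Rightarrow> ('p::finite \<Rightarrow> 'm list) \<Rightarrow> 'm set \<Rightarrow> 'm set list \<Rightarrow> bool"
where
  "round_batch f \<kappa> sel ls V ws \<longleftrightarrow>
     (\<exists>H. collapsed (payload_graph V (order_edges f \<kappa> ls V)) H \<and>
          deliver_loop sel (stable f \<kappa> ls) H ws)"

lemma order_edges_wf: "order_edges f \<kappa> ls V \<subseteq> V \<times> V" "irrefl (order_edges f \<kappa> ls V)"
  unfolding order_edges_def irrefl_def by auto

lemma collapsed_quotient_graph:
  assumes "collapsed (payload_graph V (order_edges f \<kappa> ls V)) H"
  shows "quotient_graph V (order_edges f \<kappa> ls V) H" "acyclic (snd H)"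
  using assms quotient_graph_collapse_steps
    quotient_graph_payload_graph[OF order_edges_wf]
  unfolding collapsed_def by blast+

context
  fixes f :: nat and \<kappa> :: real and sel :: "'m set set \<Rightarrow> 'm set"
    and ls :: "'p::finite \<Rightarrow> 'm list" and V :: "'m set"
  assumes sel: "\<And>X. X \<noteq> {} \<Longrightarrow> sel X \<in> X" and fin: "finite V"
begin

text \<open>Uniqueness serves total order; existence serves liveness, as it shows that the end of a
  round can always be executed.\<close>

lemma round_batch_ex1: "\<exists>!ws. round_batch f \<kappa> sel ls V ws"
proof -
  let ?E = "order_edges f \<kappa> ls V"
  obtain H where H: "collapsed (payload_graph V ?E) H"
    using quotient_graph_collapsed_exists[OF quotient_graph_payload_graph[OF order_edges_wf] fin]
    by blast
  have "finite (fst H)"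
    using collapsed_quotient_graph[OF H] quotient_graph_finite fin by blast
  then obtain ws where "deliver_loop sel (stable f \<kappa> ls) H ws"
    using deliver_loop_exists[OF sel] by blast
  then have "round_batch f \<kappa> sel ls V ws" using H unfolding round_batch_def by blast
  moreover have "ws1 = ws2"
    if ws12: "round_batch f \<kappa> sel ls V ws1" "round_batch f \<kappa> sel ls V ws2" for ws1 ws2
  proof -
    obtain H1 H2 where *: "collapsed (payload_graph V ?E) H1" "collapsed (payload_graph V ?E) H2"
      "deliver_loop sel (stable f \<kappa> ls) H1 ws1" "deliver_loop sel (stable f \<kappa> ls) H2 ws2"
      using ws12 unfolding round_batch_def by blast
    have "H1 = H2"
      using acyclic_quotient_graph_unique[OF order_edges_wf(1)] collapsed_quotient_graph *(1,2)
      by metis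
    then show ?thesis using * deliver_loop_unique[OF sel] by blast
  qed
  ultimately show ?thesis by blast
qed

lemma round_batch_disjoint:
  assumes "round_batch f \<kappa> sel ls V ws"
  shows "\<Union> (set ws) \<subseteq> V"
    and "i < length ws \<Longrightarrow> j < length ws \<Longrightarrow> m \<in> ws ! i \<Longrightarrow> m \<in> ws ! j \<Longrightarrow> i = j"
proof -
  obtain H where H: "collapsed (payload_graph V (order_edges f \<kappa> ls V)) H"
    "deliver_loop sel (stable f \<kappa> ls) H ws"
    using assms unfolding round_batch_def by blast
  note Q = quotient_graphD[OF collapsed_quotient_graph(1)[OF H(1)]]
  have ws: "set ws \<subseteq> fst H" "distinct ws" using deliver_loop_vertices[OF sel H(2)] by auto
  show "\<Union> (set ws) \<subseteq> V" using Q(2) ws by blast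
  assume ij: "i < length ws" "j < length ws" "m \<in> ws ! i" "m \<in> ws ! j"
  then have "ws ! i \<in> fst H" "ws ! j \<in> fst H" using ws by auto
  then have "ws ! i = ws ! j" using Q(4) ij by blast
  then show "i = j" using ij ws nth_eq_iff_index_eq by blast
qed

lemma round_batch_stable:
  assumes "round_batch f \<kappa> sel ls V ws" "m \<in> \<Union> (set ws)"
  shows "real (C_count ls m) \<ge> (real CARD('p) + real f - \<kappa>) / 2"
  using assms deliver_loop_vertices[OF sel] unfolding round_batch_def stable_def by blast

text \<open>An edge between payloads either lies inside one vertex, so that both are output
  together, or becomes an edge of the collapsed graph, which the loop respects.\<close>

lemma round_batch_order:
  assumes "round_batch f \<kappa> sel ls V ws" "i < length ws" "m' \<in> ws ! i"
    and edge: "(m, m') \<in> order_edges f \<kappa> ls V"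
  shows "\<exists>j\<le>i. m \<in> ws ! j"
proof -
  obtain H where H: "collapsed (payload_graph V (order_edges f \<kappa> ls V)) H"
    "deliver_loop sel (stable f \<kappa> ls) H ws"
    using assms unfolding round_batch_def by blast
  note Q = quotient_graphD[OF collapsed_quotient_graph(1)[OF H(1)]]
  have w: "ws ! i \<in> fst H"
    using deliver_loop_vertices[OF sel H(2)] nth_mem[OF assms(2)] by blast
  have "m \<in> V" using edge unfolding order_edges_def by simp
  then obtain u where u: "u \<in> fst H" "m \<in> u" using Q(2) by blast
  show ?thesis
  proof (cases "u = ws ! i")
    case True then show ?thesis using u by auto
  next
    case False
    then have "(u, ws ! i) \<in> snd H" using Q(5) u w assms(3) edge by blast
    then obtain j where "j < i" "ws ! j = u" using deliver_loop_order[OF sel H(2) assms(2)] by blast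
    then show ?thesis using u by (intro exI[of _ j]) auto
  qed
qed

lemma round_batch_complete:
  assumes "round_batch f \<kappa> sel ls V ws"
    and "\<And>m. m \<in> V \<Longrightarrow> real (C_count ls m) \<ge> (real CARD('p) + real f - \<kappa>) / 2"
  shows "V \<subseteq> \<Union> (set ws)"
proof -
  obtain H where H: "collapsed (payload_graph V (order_edges f \<kappa> ls V)) H"
    "deliver_loop sel (stable f \<kappa> ls) H ws"
    using assms unfolding round_batch_def by blast
  note Q = collapsed_quotient_graph(1)[OF H(1)]
  note V = quotient_graphD(2)[OF Q]
  have "fst H \<subseteq> set ws"
  proof (rule deliver_loop_complete[OF sel H(2)])
    show "\<forall>w\<in>fst H. stable f \<kappa> ls w" using assms(2) V unfolding stable_def by blast
    show "snd H \<subseteq> fst H \<times> fst H" using quotient_graphD(6)[OF Q] .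
  qed (use quotient_graph_finite[OF Q fin] collapsed_quotient_graph[OF H(1)] in auto)
  then show ?thesis using V by blast
qed

end

section \<open>The state of a correct process\<close>

text \<open>Guarantees that a transferred payload lands at the list position named by its label,
  exactly as a payload delivered by the channel does.\<close>

lemma get_messages_source:
  "i < length (get_messages k c xs) \<Longrightarrow>
   (k, Suc (c + i), get_messages k c xs ! i) \<in> set xs"
proof (induction k c xs arbitrary: i rule: get_messages.induct)
  case (2 k c k' l m xs)
  show ?case
  proof (cases "k' = k \<and> l = Suc c")
    case True
    then show ?thesis using 2 by (cases i) auto
  next
    case False
    then show ?thesis using 2 by auto
  qed
qed simp

locale ofab_execution =
  fixes \<pi> :: "('p::finite, 'm, 'sig, 'str) params"
    and Cor :: "'p set"
    and \<rho> :: "('p, 'm, 'sig, 'str) run"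
  assumes resilience: "CARD('p) > 3 * faults \<pi>"
    and kappa_nonneg: "kappa \<pi> \<ge> 0"

    and params: "params_ok \<pi>"
    and run: "protocol_run \<pi> Cor \<rho>"
    and fair: "fair_run \<pi> Cor \<rho>"
    and secure: "signatures_secure \<pi> Cor \<rho>"
    and channel: "bcch_channel \<pi> Cor \<rho>"
    and consensus: "validated_consensus \<pi> Cor \<rho>"
    and all_bcast: "all_correct_broadcast Cor (of_bcast \<rho>)"
begin

lemma select_in: "X \<noteq> {} \<Longrightarrow> select \<pi> X \<in> X"
  using params unfolding params_ok_def by blast

lemma link_init: "link \<rho> 0 q p = []"
  using run unfolding protocol_run_def by blast

lemma st_init: "p \<in> Cor \<Longrightarrow> st \<rho> 0 p = init_state"
  using run unfolding protocol_run_def by blast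

lemma event_step:
  assumes "ev \<rho> t = Some (p, a)"
  obtains out where "p \<in> Cor" "lstep \<pi> p a (st \<rho> t p) (st \<rho> (Suc t) p) out"
    "\<And>q. q \<noteq> p \<Longrightarrow> st \<rho> (Suc t) q = st \<rho> t q"
    "link \<rho> (Suc t) =
       (\<lambda>x y. in_transit Cor p a (link \<rho> t) x y @ (if x = p then out y else []))"
    "\<And>q \<mu>. a = Receive q \<mu> \<Longrightarrow> q \<in> Cor \<Longrightarrow> link \<rho> t q p \<noteq> [] \<and> hd (link \<rho> t q p) = \<mu>"
proof -
  have "p \<in> Cor \<and>
          (\<forall>q \<mu>. a = Receive q \<mu> \<and> q \<in> Cor \<longrightarrow> link \<rho> t q p \<noteq> [] \<and> hd (link \<rho> t q p) = \<mu>) \<and>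
          (\<exists>s' out. lstep \<pi> p a (st \<rho> t p) s' out \<and>
             st \<rho> (Suc t) = (st \<rho> t)(p := s') \<and>
             link \<rho> (Suc t) =
               (\<lambda>x y. in_transit Cor p a (link \<rho> t) x y @ (if x = p then out y else [])))"
    using run assms unfolding protocol_run_def by (auto dest: spec[of _ t])
  then show ?thesis using that by auto
qed

lemma no_event_step: "ev \<rho> t = None \<Longrightarrow> st \<rho> (Suc t) = st \<rho> t \<and> link \<rho> (Suc t) = link \<rho> t"
  using run unfolding protocol_run_def by (auto dest: spec[of _ t])

text \<open>Events of other processes do not touch the state of \<open>p\<close> and are counted as
  \<open>idle\<close>.\<close>

lemma state_step_cases:
  obtains (idle) "st \<rho> (Suc t) p = st \<rho> t p"
  | (step) a out where "ev \<rho> t = Some (p, a)" "p \<in> Cor" "lstep \<pi> p a (st \<rho> t p) (st \<rho> (Suc t) p) out"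
proof (cases "ev \<rho> t")
  case None then show ?thesis using no_event_step idle by simp
next
  case (Some e)
  obtain q a where e: "e = (q, a)" by (cases e)
  show ?thesis
    using Some e event_step[of t q a] idle step[of a] by (cases "q = p") metis+
qed

lemma state_induct [consumes 1, case_names init idle step]:
  assumes "p \<in> Cor" "st \<rho> 0 p = init_state \<Longrightarrow> P 0"
    and "\<And>t. st \<rho> (Suc t) p = st \<rho> t p \<Longrightarrow> P t \<Longrightarrow> P (Suc t)"
    and "\<And>t a out. ev \<rho> t = Some (p, a) \<Longrightarrow> lstep \<pi> p a (st \<rho> t p) (st \<rho> (Suc t) p) out \<Longrightarrow>
           P t \<Longrightarrow> P (Suc t)"
  shows "P t"
proof (induction t)
  case 0 then show ?case using assms(1,2) st_init by simp
next
  case (Suc t)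
  show ?case
    by (rule state_step_cases[of t p]) (use Suc assms(3,4) in auto)
qed

lemma lstep_mono:
  assumes "lstep \<pi> p a s s' out"
  shows "prefix (msgs s k) (msgs s' k)" "rnd s \<le> rnd s'"
    and "cuts s r = Some c \<Longrightarrow> cuts s' r = Some c"
  using assms by (cases, auto)+

lemma state_mono:
  assumes "t \<le> t'"
  shows "prefix (msgs (st \<rho> t p) k) (msgs (st \<rho> t' p) k)" "rnd (st \<rho> t p) \<le> rnd (st \<rho> t' p)"
    and "cuts (st \<rho> t p) r = Some c \<Longrightarrow> cuts (st \<rho> t' p) r = Some c"
proof -
  have "prefix (msgs (st \<rho> t p) k) (msgs (st \<rho> t' p) k) \<and> rnd (st \<rho> t p) \<le> rnd (st \<rho> t' p) \<and>
    (cuts (st \<rho> t p) r = Some c \<longrightarrow> cuts (st \<rho> t' p) r = Some c)"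
    using assms
  proof (induction rule: dec_induct)
    case (step u)
    show ?case
      by (rule state_step_cases[of u p])
        (use step.IH in \<open>auto dest: lstep_mono(1)[where k = k] lstep_mono(2,3)
           intro: prefix_order.trans order_trans\<close>)
  qed simp
  then show "prefix (msgs (st \<rho> t p) k) (msgs (st \<rho> t' p) k)" "rnd (st \<rho> t p) \<le> rnd (st \<rho> t' p)"
    "cuts (st \<rho> t p) r = Some c \<Longrightarrow> cuts (st \<rho> t' p) r = Some c"
    by blast+
qed

lemma length_msgs_mono:
  "t \<le> t' \<Longrightarrow> length (msgs (st \<rho> t p) k) \<le> length (msgs (st \<rho> t' p) k)"
  using state_mono(1) prefix_length_le by blast

lemma rnd_pos: "p \<in> Cor \<Longrightarrow> 1 \<le> rnd (st \<rho> t p)"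
  using state_mono(2)[of 0 t p] st_init by (simp add: init_state_def)

lemma vc_eq_length:
  assumes p: "p \<in> Cor"
  shows "vc (st \<rho> t p) k = length (msgs (st \<rho> t p) k)"
  using p
proof (induction t rule: state_induct)
  case (step t a out)
  from step.hyps(2) step.IH show ?case by cases auto
qed (simp_all add: init_state_def)

lemma inbox_received:
  assumes p: "p \<in> Cor"
  shows "(q, \<mu>) \<in> inbox (st \<rho> t p) \<Longrightarrow> \<exists>t'<t. ev \<rho> t' = Some (p, Receive q \<mu>)"
  using p
proof (induction t rule: state_induct)
  case (step t a out)
  from step.hyps(2) have "(q, \<mu>) \<in> inbox (st \<rho> t p) \<or> a = Receive q \<mu>"
    using step.prems by cases auto
  then show ?case using step.hyps(1) step.IH less_Suc_eq by blast
qed (auto simp: init_state_def less_Suc_eq)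

section \<open>The global message sequence of every sender\<close>

definition bcch_delivered :: "'p \<Rightarrow> nat \<Rightarrow> 'm \<Rightarrow> bool" where
  "bcch_delivered k l m \<longleftrightarrow> (\<exists>p\<in>Cor. \<exists>t. ev \<rho> t = Some (p, BcchDeliver k l m))"

text \<open>Positions are counted from 0, labels from 1. The choice is unique by consistency once
  some correct process has delivered the label, and arbitrary otherwise.\<close>

definition msg_at :: "'p \<Rightarrow> nat \<Rightarrow> 'm" where
  "msg_at k i = (SOME m. bcch_delivered k (Suc i) m)"

lemma bcch_delivered_msg_at: "bcch_delivered k (Suc i) m \<Longrightarrow> msg_at k i = m"
proof -
  assume m: "bcch_delivered k (Suc i) m"
  moreover from this have "bcch_delivered k (Suc i) (msg_at k i)"
    unfolding msg_at_def by (rule someI)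
  ultimately show ?thesis
    using channel unfolding bcch_delivered_def bcch_channel_def bcch_consistency_def by blast
qed

text \<open>A channel delivery carries the next label because instances are sequential. A payload
  obtained by transfer need not have been delivered to \<open>p\<close> by the channel, but its
  proof cannot be forged, so the channel delivered it to some correct process.\<close>

lemma msgs_bcch_delivered:
  assumes p: "p \<in> Cor"
  shows "i < length (msgs (st \<rho> t p) k) \<Longrightarrow>
   bcch_delivered k (Suc i) (msgs (st \<rho> t p) k ! i)"
  using p
proof (induction t rule: state_induct)
  case (step t a out)
  note IH = step.IH
  from step.hyps(2) show ?case
  proof cases
    case (bcch_deliver k' l m)
    show ?thesis
    proof (cases "k' = k \<and> i = length (msgs (st \<rho> t p) k)")
      case True
      have "l = length (msgs (st \<rho> t p) k) + 1"
        using channel step.hyps(1) bcch_deliver True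
        unfolding bcch_channel_def bcch_sequenced_def by blast
      then show ?thesis using True step.hyps(1) bcch_deliver p unfolding bcch_delivered_def
        by auto
    next
      case False
      then have "i < length (msgs (st \<rho> t p) k)"
        using step.prems bcch_deliver by (auto split: if_splits)
      then show ?thesis using IH False bcch_deliver by (auto simp: nth_append)
    qed
  next
    case (handle_resend q r' k' str new)
    show ?thesis
    proof (cases "i < length (msgs (st \<rho> t p) k)")
      case True
      then show ?thesis using IH handle_resend by (auto simp: nth_append)
    next
      case False
      define c where "c = length (msgs (st \<rho> t p) k)"
      define xs where "xs = proof_contents \<pi> str"
      have k': "k' = k" and ver: "verify_proof \<pi> str"
        using False step.prems handle_resend by (auto split: if_splits)
      have new: "new = get_messages k c xs"
        using handle_resend ver k' unfolding c_def xs_def by simp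
      have i: "i - c < length new"
        using False step.prems handle_resend k' unfolding c_def by (auto split: if_splits)
      have "(k, Suc i, new ! (i - c)) \<in> set xs"
        using get_messages_source[of "i - c" k c xs] i new False unfolding c_def by simp
      moreover obtain t' where "ev \<rho> t' = Some (p, Receive q (RESEND r' k str))"
        using inbox_received[OF p] handle_resend k' by blast
      ultimately have "bcch_delivered k (Suc i) (new ! (i - c))"
        using channel ver unfolding bcch_channel_def bcch_unforgeable_def bcch_delivered_def xs_def
        by fast
      then show ?thesis using False handle_resend k' unfolding c_def by (simp add: nth_append)
    qed
  qed (use IH step.prems in auto)
qed (simp_all add: init_state_def)

lemma msgs_nth:
  "p \<in> Cor \<Longrightarrow> i < length (msgs (st \<rho> t p) k) \<Longrightarrow> msgs (st \<rho> t p) k ! i = msg_at k i"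
  using msgs_bcch_delivered bcch_delivered_msg_at by metis

lemma take_msgs:
  "p \<in> Cor \<Longrightarrow> c \<le> length (msgs (st \<rho> t p) k) \<Longrightarrow>
   take c (msgs (st \<rho> t p) k) = map (msg_at k) [0..<c]"
  by (rule nth_equalityI) (auto simp: msgs_nth)

end

section \<open>Total order and fairness\<close>

text \<open>Split at the first \<open>m\<close>: an \<open>m'\<close> ahead of it would require a
  still earlier \<open>m\<close>. The condition \<open>first\<close> is what FIFO delivery
  provides.\<close>

lemma occurs_beforeI:
  assumes "m' \<in> set xs" and "m \<noteq> m'"
    and first: "\<And>i. i < length xs \<Longrightarrow> xs ! i = m' \<Longrightarrow> \<exists>i'<i. xs ! i' = m"
  shows "occurs_before xs m m'"
proof -
  have "m \<in> set xs" using assms(1) first by (metis in_set_conv_nth less_trans)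
  then obtain ys zs where xs: "xs = ys @ m # zs" "m \<notin> set ys"
    using split_list_first by fastforce
  have "m' \<notin> set ys"
  proof
    assume "m' \<in> set ys"
    then obtain i where i: "i < length ys" "ys ! i = m'" by (auto simp: in_set_conv_nth)
    then obtain i' where "i' < i" "xs ! i' = m"
      using first[of i] xs(1) by (auto simp: nth_append)
    then show False using xs i by (auto simp: nth_append)
  qed
  then show ?thesis unfolding occurs_before_def using xs assms(1,2) by auto
qed

lemma occurs_before_asym: "occurs_before xs m m' \<Longrightarrow> \<not> occurs_before xs m' m"
  unfolding occurs_before_def by (auto simp: append_eq_append_conv2 Cons_eq_append_conv append_eq_Cons_conv)

lemma occurs_before_set: "occurs_before xs m m' \<Longrightarrow> m \<in> set xs \<and> m' \<in> set xs"
  unfolding occurs_before_def by auto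

context ofab_execution
begin

text \<open>FIFO delivery speaks of channel events, whereas \<open>p\<close> may hold entry
  \<open>i\<close> by transfer. The argument therefore passes to a process \<open>p'\<close> to
  which the channel delivered label \<open>Suc i\<close>: at that moment its list had exactly
  \<open>i\<close> entries, and \<open>m\<close> was among them.\<close>

lemma bcch_fifo_msg_at:
  assumes "p \<in> Cor" "k \<in> Cor" "i < length (msgs (st \<rho> t p) k)"
    and before: "bc_before (of_bcast \<rho>) k m (msg_at k i)"
  shows "\<exists>i'<i. msg_at k i' = m"
proof -
  obtain p' t' where d: "p' \<in> Cor" "ev \<rho> t' = Some (p', BcchDeliver k (Suc i) (msg_at k i))"
    using msgs_bcch_delivered[OF assms(1,3)] msgs_nth[OF assms(1,3)]
    unfolding bcch_delivered_def by auto
  then have "m \<in> set (msgs (st \<rho> t' p') k)"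
    using channel assms(2) before unfolding bcch_channel_def bcch_fifo_def by blast
  moreover have "Suc i = length (msgs (st \<rho> t' p') k) + 1"
    using channel d(2) unfolding bcch_channel_def bcch_sequenced_def by blast
  ultimately show ?thesis using msgs_nth[OF d(1)] by (metis Suc_eq_plus1 in_set_conv_nth nat.inject)
qed

lemma msg_at_broadcast:
  assumes "p \<in> Cor" "k \<in> Cor" "i < length (msgs (st \<rho> t p) k)"
  shows "\<exists>t'. of_bcast \<rho> t' k (msg_at k i)"
proof -
  obtain p' t' where "p' \<in> Cor" "ev \<rho> t' = Some (p', BcchDeliver k (Suc i) (msg_at k i))"
    using msgs_bcch_delivered[OF assms(1,3)] msgs_nth[OF assms(1,3)]
    unfolding bcch_delivered_def by auto
  then show ?thesis
    using channel assms(2) unfolding bcch_channel_def bcch_integrity_def by blast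
qed

section \<open>Decisions and cuts as functions of the round\<close>

definition vbc_decided :: "nat \<Rightarrow> ('p, 'sig) vbc_value \<Rightarrow> bool" where
  "vbc_decided r v \<longleftrightarrow> (\<exists>p\<in>Cor. \<exists>t. vbc_decides \<rho> t p r v)"

text \<open>Meaningful only for rounds with a decision, which is then unique by agreement.\<close>

definition cut_at :: "nat \<Rightarrow> 'p \<Rightarrow> nat" where
  "cut_at r = cut_of (faults \<pi>) (fst (SOME v. vbc_decided r v))"

lemma vbc_decided_unique: "vbc_decided r v \<Longrightarrow> vbc_decided r v' \<Longrightarrow> v = v'"
  using consensus unfolding vbc_decided_def validated_consensus_def vbc_agreement_def by blast

lemma cut_at_decided: "vbc_decided r v \<Longrightarrow> cut_at r = cut_of (faults \<pi>) (fst v)"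
  unfolding cut_at_def using vbc_decided_unique someI[of "vbc_decided r" v] by metis

lemma decision_decided:
  assumes p: "p \<in> Cor"
  shows "decision (st \<rho> t p) r = Some v \<Longrightarrow> vbc_decided r v"
  using p
proof (induction t rule: state_induct)
  case (step t a out)
  show ?case
  proof (cases "a = VbcDecide r v")
    case True
    then show ?thesis using p step.hyps(1) unfolding vbc_decided_def vbc_decides_def by blast
  next
    case False
    from step.hyps(2) have "decision (st \<rho> t p) r = Some v"
      using step.prems False by cases (auto split: if_splits)
    then show ?thesis by (rule step.IH)
  qed
qed (simp_all add: init_state_def)

lemma cuts_decided:
  assumes p: "p \<in> Cor"
  shows "cuts (st \<rho> t p) r = Some c \<Longrightarrow> c = cut_at r \<and> (\<exists>v. vbc_decided r v) \<and> r \<le> rnd (st \<rho> t p)"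
  using p
proof (induction t rule: state_induct)
  case (step t a out)
  from step.hyps(2) show ?case
  proof cases
    case (handle_decide L' \<Sigma>' c' js)
    then have "vbc_decided (rnd (st \<rho> t p)) (L', \<Sigma>')" using decision_decided[OF p] by blast
    then show ?thesis
      using handle_decide step.IH step.prems cut_at_decided by (auto split: if_splits)
  qed (use step.IH step.prems in auto)
qed (simp_all add: init_state_def)

lemma current_cut:
  assumes p: "p \<in> Cor"
  shows "cut (st \<rho> t p) =
    (if cuts (st \<rho> t p) (rnd (st \<rho> t p)) \<noteq> None then cut_at (rnd (st \<rho> t p))
     else if rnd (st \<rho> t p) = 1 then \<lambda>_. 0 else cut_at (rnd (st \<rho> t p) - 1))"
  using p
proof (induction t rule: state_induct)
  case (step t a out)
  from step.hyps(2) show ?case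
  proof cases
    case (handle_decide L' \<Sigma>' c' js)
    then have "vbc_decided (rnd (st \<rho> t p)) (L', \<Sigma>')" using decision_decided[OF p] by blast
    then show ?thesis using handle_decide cut_at_decided by auto
  next
    case (finish_round ls V H ws)
    \<comment> \<open>No cut of a later round is recorded yet, so after the round number is
      increased the variable \<open>cut\<close> holds the cut of the round just finished.\<close>
    have "cuts (st \<rho> t p) (Suc (rnd (st \<rho> t p))) = None"
      using cuts_decided[OF p, of t "Suc (rnd (st \<rho> t p))"] by (metis not_None_eq not_less_eq_eq order_refl)
    then show ?thesis using finish_round step.IH rnd_pos[OF p, of t] by auto
  qed (use step.IH in auto)
qed (simp_all add: init_state_def)

text \<open>A round can be left only after its cut is fixed and all lists reach it, and both facts
  persist. Hence a process that is ahead can always serve those that lag behind.\<close>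

lemma finished_round:
  assumes p: "p \<in> Cor"
  shows "1 \<le> r \<Longrightarrow> r < rnd (st \<rho> t p) \<Longrightarrow>
    cuts (st \<rho> t p) r = Some (cut_at r) \<and> (\<forall>k. cut_at r k \<le> length (msgs (st \<rho> t p) k))"
  using p
proof (induction t rule: state_induct)
  case (step t a out)
  note mono = state_mono(3)[of t "Suc t" p r "cut_at r"] length_msgs_mono[of t "Suc t" p]
  show ?case
  proof (cases "r < rnd (st \<rho> t p)")
    case True
    then show ?thesis using step.IH step.prems mono order_trans by fastforce
  next
    case False
    from step.hyps(2) show ?thesis
    proof cases
      case (finish_round ls V H ws)
      then have r: "r = rnd (st \<rho> t p)" using step.prems False by simp
      then have "cuts (st \<rho> t p) r = Some (cut_at r)"
        using finish_round(4) cuts_decided[OF p, of t r] by auto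
      moreover from this have "cut (st \<rho> t p) = cut_at r" using current_cut[OF p, of t] r by simp
      ultimately show ?thesis using finish_round by auto
    qed (use step.prems False in auto)
  qed
qed (simp_all add: init_state_def)

section \<open>The log as a function of the round\<close>

definition seg :: "nat \<Rightarrow> 'p \<Rightarrow> 'm list" where
  "seg r k = map (msg_at k) [0..<cut_at r k]"

definition pool :: "nat \<Rightarrow> 'm set \<Rightarrow> 'm set" where
  "pool r D = (\<Union>k. set (seg r k)) - D"

text \<open>The description is proper because the pool is finite, so that
  \<open>round_batch_ex1\<close> applies.\<close>

definition batch :: "nat \<Rightarrow> 'm set \<Rightarrow> 'm set list" where
  "batch r D = (THE ws. round_batch (faults \<pi>) (kappa \<pi>) (select \<pi>) (seg r) (pool r D) ws)"

text \<open>\<open>rlog r\<close> is the log of every correct process at the beginning of round \<open>r\<close>; the value at 0 is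
  junk, as rounds are counted from 1.\<close>

primrec rlog :: "nat \<Rightarrow> 'm set list" where
  "rlog 0 = []"
| "rlog (Suc r) = (if r = 0 then [] else rlog r @ batch r (\<Union> (set (rlog r))))"

lemma finite_pool: "finite (pool r D)"
  unfolding pool_def by simp

lemma round_batch_iff:
  "round_batch (faults \<pi>) (kappa \<pi>) (select \<pi>) (seg r) (pool r D) ws \<longleftrightarrow> ws = batch r D"
proof -
  have *: "\<exists>!ws. round_batch (faults \<pi>) (kappa \<pi>) (select \<pi>) (seg r) (pool r D) ws"
    by (rule round_batch_ex1[OF select_in finite_pool])
  show ?thesis
    using the1_equality[OF *, of ws] theI'[OF *] unfolding batch_def by auto
qed

lemma round_batch_batch:
  "round_batch (faults \<pi>) (kappa \<pi>) (select \<pi>) (seg r) (pool r D) (batch r D)"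
  using round_batch_iff by blast

lemma rlog_mono: "r \<le> r' \<Longrightarrow> prefix (rlog r) (rlog r')"
proof (induction rule: dec_induct)
  case (step n)
  then show ?case by (cases n) (auto intro: prefix_order.trans)
qed simp

lemma rlog_nth_batch:
  assumes "i < length (rlog R)"
  obtains r i' where "1 \<le> r" "r < R" "i = length (rlog r) + i'"
    "i' < length (batch r (\<Union> (set (rlog r))))" "rlog R ! i = batch r (\<Union> (set (rlog r))) ! i'"
    "rlog (Suc r) = rlog r @ batch r (\<Union> (set (rlog r)))"
  using assms
proof (induction R arbitrary: thesis)
  case (Suc R)
  show ?case
  proof (cases "i < length (rlog R)")
    case True
    obtain r i' where "1 \<le> r" "r < R" "i = length (rlog r) + i'"
      "i' < length (batch r (\<Union> (set (rlog r))))" "rlog R ! i = batch r (\<Union> (set (rlog r))) ! i'"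
      "rlog (Suc r) = rlog r @ batch r (\<Union> (set (rlog r)))"
      using Suc.IH[OF _ True] by blast
    moreover have "R \<noteq> 0" using True by (cases R) auto
    ultimately show ?thesis using Suc.prems(1)[of r i'] True by (simp add: nth_append)
  next
    case False
    moreover have "R \<noteq> 0" using Suc.prems(2) by (cases R) auto
    ultimately show ?thesis
      using Suc.prems(1)[of R "i - length (rlog R)"] Suc.prems(2) by (simp add: nth_append)
  qed
qed simp

text \<open>Within a batch the vertices are disjoint, and a later batch is drawn from a pool from
  which everything output earlier has been removed.\<close>

lemma rlog_disjoint:
  "i < length (rlog R) \<Longrightarrow> j < length (rlog R) \<Longrightarrow> m \<in> rlog R ! i \<Longrightarrow> m \<in> rlog R ! j \<Longrightarrow> i = j"
proof (induction R arbitrary: i j)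
  case (Suc R)
  define D where "D = \<Union> (set (rlog R))"
  have R: "R \<noteq> 0" using Suc.prems(1) by (cases R) auto
  note batch = round_batch_disjoint[OF select_in finite_pool round_batch_batch[of R D]]
  have new: "m \<notin> D" if "m \<in> batch R D ! i" "i < length (batch R D)" for i
    using batch(1) that unfolding pool_def by fastforce
  have old: "m \<in> D" if "m \<in> rlog R ! i" "i < length (rlog R)" for i
    unfolding D_def using that by auto
  let ?L = "length (rlog R)"
  have mem: "i < ?L \<and> m \<in> rlog R ! i \<and> m \<in> D \<or>
      ?L \<le> i \<and> i - ?L < length (batch R D) \<and> m \<in> batch R D ! (i - ?L) \<and> m \<notin> D"
    if i: "i < length (rlog (Suc R))" "m \<in> rlog (Suc R) ! i" for i
  proof (cases "i < ?L")
    case True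
    then show ?thesis using i R old[of i] by (simp add: nth_append)
  next
    case False
    then have "m \<in> batch R D ! (i - ?L)" "i - ?L < length (batch R D)"
      using i R unfolding D_def by (auto simp: nth_append)
    then show ?thesis using False new by simp
  qed
  from mem[OF Suc.prems(1,3)] mem[OF Suc.prems(2,4)] show ?case
    using Suc.IH batch(2)[of "i - ?L" "j - ?L" m] eq_diff_iff[of ?L i j] by blast
qed simp

text \<open>When a round ends, the lists reach the common cut, so by \<open>take_msgs\<close> the
  prefixes are those of \<open>seg\<close>. By induction the delivered payloads agree too, and the
  batch is unique.\<close>

lemma olog_eq_rlog:
  assumes p: "p \<in> Cor"
  shows "olog (st \<rho> t p) = rlog (rnd (st \<rho> t p)) \<and>
    delivered (st \<rho> t p) = \<Union> (set (olog (st \<rho> t p)))"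
  using p
proof (induction t rule: state_induct)
  case (step t a out)
  from step.hyps(2) show ?case
  proof cases
    case (finish_round ls V H ws)
    define r where "r = rnd (st \<rho> t p)"
    have r: "1 \<le> r" using rnd_pos[OF p] r_def by simp
    have cut: "cut (st \<rho> t p) = cut_at r" using current_cut[OF p, of t] finish_round r_def by simp
    have ls: "ls = seg r"
      unfolding finish_round(6) seg_def cut
      using finish_round(5) take_msgs[OF p] unfolding cut by (intro ext) blast
    have V: "V = pool r (\<Union> (set (rlog r)))"
      unfolding finish_round(7) pool_def ls using step.IH r_def by simp
    have "round_batch (faults \<pi>) (kappa \<pi>) (select \<pi>) ls V ws"
      unfolding round_batch_def using finish_round(8,9) by blast
    then have "ws = batch r (\<Union> (set (rlog r)))" unfolding ls V round_batch_iff .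
    then show ?thesis using finish_round(2) step.IH r r_def by simp
  qed (use step.IH in auto)
qed (simp_all add: init_state_def)

lemma of_log_eq_rlog: "p \<in> Cor \<Longrightarrow> of_log \<rho> t p = rlog (rnd (st \<rho> t p))"
  unfolding of_log_def using olog_eq_rlog by blast

lemma no_duplication: "of_no_duplication Cor (of_log \<rho>)"
  unfolding of_no_duplication_def using of_log_eq_rlog rlog_disjoint by metis

lemma total_order: "of_total_order Cor (of_log \<rho>)"
proof -
  have "of_before (of_log \<rho>) q m m'"
    if p: "p \<in> Cor" and q: "q \<in> Cor" and qm: "of_delivers (of_log \<rho>) q m"
      and before: "of_before (of_log \<rho>) p m m'" for p q m m'
  proof -
    obtain t i where i: "i < length (of_log \<rho> t p)" "m \<in> of_log \<rho> t p ! i"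
      "\<forall>j\<le>i. m' \<notin> of_log \<rho> t p ! j"
      using before unfolding of_before_def by blast
    obtain t' where "m \<in> \<Union> (set (of_log \<rho> t' q))" using qm unfolding of_delivers_def by blast
    then obtain j where j: "j < length (of_log \<rho> t' q)" "m \<in> of_log \<rho> t' q ! j"
      by (auto simp: in_set_conv_nth)
    define R R' where "R = rlog (rnd (st \<rho> t p))" and "R' = rlog (rnd (st \<rho> t' q))"
    have R: "of_log \<rho> t p = R" and R': "of_log \<rho> t' q = R'"
      unfolding R_def R'_def using of_log_eq_rlog p q by auto
    \<comment> \<open>All logs are prefixes of one growing sequence, so any two are comparable; it
      remains to see that position \<open>i\<close> lies within the log of \<open>q\<close>.\<close>
    have "prefix R R' \<or> prefix R' R" unfolding R_def R'_def using rlog_mono nat_le_linear by blast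
    then have "i < length R' \<and> (\<forall>j\<le>i. R' ! j = R ! j)"
    proof
      assume "prefix R R'"
      then show ?thesis using i(1) unfolding R by (auto simp: prefix_def nth_append)
    next
      assume *: "prefix R' R"
      \<comment> \<open>If the log of \<open>q\<close> is the shorter one, it still contains
        \<open>m\<close>, and a payload has only one position.\<close>
      then have "j = i" using i j rlog_disjoint unfolding R R' R_def
        by (metis R_def nth_append order_less_le_trans prefix_def prefix_length_le)
      then show ?thesis using * j(1) unfolding R' by (auto simp: prefix_def nth_append)
    qed
    then show ?thesis unfolding of_before_def
      using i unfolding R by (intro exI[of _ t'] exI[of _ i]) (auto simp: R')
  qed
  then show ?thesis unfolding of_total_order_def by blast
qed

lemma differential_order_fairness:
  "of_differential_order_fairness (faults \<pi>) (kappa \<pi>) Cor (of_bcast \<rho>) (of_log \<rho>)"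
proof -
  let ?f = "faults \<pi>" and ?n = "CARD('p)" and ?bc = "of_bcast \<rho>"
  have "\<not> of_before (of_log \<rho>) p m' m"
    if K: "K \<subseteq> Cor" "?n - ?f \<le> card K"
      and bm: "\<exists>p\<in>Cor. \<exists>t. ?bc t p m" "\<exists>p\<in>Cor. \<exists>t. ?bc t p m'"
      and diff: "real (bc_count ?bc K m m') > real (bc_count ?bc K m' m) + 2 * real ?f + kappa \<pi>"
      and p: "p \<in> Cor" for K m m' p
  proof
    assume "of_before (of_log \<rho>) p m' m"
    then obtain t i where "i < length (of_log \<rho> t p)" "m' \<in> of_log \<rho> t p ! i"
      "\<forall>j\<le>i. m \<notin> of_log \<rho> t p ! j"
      unfolding of_before_def by blast
    then have i: "i < length (rlog (rnd (st \<rho> t p)))" "m' \<in> rlog (rnd (st \<rho> t p)) ! i"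
      and not_m: "\<forall>j\<le>i. m \<notin> rlog (rnd (st \<rho> t p)) ! j"
      using of_log_eq_rlog[OF p] by auto
    obtain r i' where r: "1 \<le> r" "r < rnd (st \<rho> t p)" and i': "i = length (rlog r) + i'"
        "i' < length (batch r (\<Union> (set (rlog r))))"
        "rlog (rnd (st \<rho> t p)) ! i = batch r (\<Union> (set (rlog r))) ! i'"
      and Suc: "rlog (Suc r) = rlog r @ batch r (\<Union> (set (rlog r)))"
      using rlog_nth_batch[OF i(1)] by metis
    define D where "D = \<Union> (set (rlog r))"
    have pre: "prefix (rlog r @ batch r D) (rlog (rnd (st \<rho> t p)))"
      using rlog_mono[of "Suc r" "rnd (st \<rho> t p)"] r Suc unfolding D_def by simp
    have not_D: "m \<notin> D"
    proof
      assume "m \<in> D"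
      then obtain j where "j < length (rlog r)" "m \<in> rlog r ! j"
        unfolding D_def by (auto simp: in_set_conv_nth)
      then show False using not_m pre i'(1) by (auto simp: prefix_def nth_append dest!: spec[of _ j])
    qed
    have not_batch: "m \<notin> batch r D ! j" if "j \<le> i'" for j
    proof -
      have "rlog (rnd (st \<rho> t p)) ! (length (rlog r) + j) = batch r D ! j"
        using pre that i'(2) unfolding D_def[symmetric] by (auto simp: prefix_def nth_append)
      then show ?thesis using not_m that i'(1) by (metis nat_add_left_cancel_le)
    qed
    have m': "m' \<in> batch r D ! i'" "i' < length (batch r D)" using i i' unfolding D_def by auto
    note batch = round_batch_batch[of r D]
    have len: "cut_at r k \<le> length (msgs (st \<rho> t p) k)" for k
      using finished_round[OF p r] by blast
    \<comment> \<open>\<open>A\<close> and \<open>B\<close> split \<open>K\<close> by broadcast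
      order. \<open>X\<close> is counted by \<open>C[m']\<close> and \<open>Y\<close> by
      \<open>M[m'][m]\<close>; both are compared with \<open>B \<union> - K\<close>, the processes
      that may speak against \<open>m\<close>.\<close>
    define A where "A = {k \<in> K. bc_before ?bc k m m'}"
    define B where "B = {k \<in> K. bc_before ?bc k m' m}"
    define X where "X = {k. m' \<in> set (seg r k)}"
    define Y where "Y = {k. occurs_before (seg r k) m' m}"
    have AB: "real (card A) > real (card B) + 2 * real ?f + kappa \<pi>"
      using diff unfolding A_def B_def bc_count_def .
    have neq: "m \<noteq> m'" using AB kappa_nonneg unfolding A_def B_def by auto
    have "A \<union> B = K"
    proof -
      have "k \<in> A \<union> B" if k: "k \<in> K" for k
      proof -
        have k': "k \<in> Cor" using K(1) k by blast
        have "\<exists>s. ?bc s k m \<or> ?bc s k m'"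
          using all_bcast bm(1) k' unfolding all_correct_broadcast_def by blast
        \<comment> \<open>The earliest broadcast of either payload decides the order; a tie is
          impossible, as there is one event at a time.\<close>
        then obtain s where "?bc s k m \<or> ?bc s k m'" "\<forall>s'<s. \<not> (?bc s' k m \<or> ?bc s' k m')"
          using exists_least_iff[of "\<lambda>s. ?bc s k m \<or> ?bc s k m'"] by blast
        moreover have "\<not> (?bc s k m \<and> ?bc s k m')" using neq unfolding of_bcast_def by auto
        ultimately have "bc_before ?bc k m m' \<or> bc_before ?bc k m' m"
          unfolding bc_before_def by (metis le_neq_implies_less)
        then show ?thesis using k unfolding A_def B_def by auto
      qed
      then show ?thesis unfolding A_def B_def by blast
    qed
    moreover have "A \<inter> B = {}"
      unfolding A_def B_def bc_before_def using nat_le_linear by blast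
    ultimately have card_K: "card K = card A + card B" by (metis card_Un_disjoint finite)
    have card_BK: "card (B \<union> - K) \<le> card B + (?n - card K)"
      using card_Un_le[of B "- K"] card_Diff_subset[of K UNIV] by (simp add: Compl_eq_Diff_UNIV)
    have "card K \<le> ?n" by (simp add: card_mono)
    \<comment> \<open>With a = |A|, b = |B| and k = |K|: a + b = k and a > b + 2f + \<kappa> give 2b
      + \<kappa> < k - 2f, so 2(b + n - k) + \<kappa> < 2n - k - 2f, which is at most n - f because
      k is at least n - f.\<close>
    then have bound: "2 * real (card (B \<union> - K)) + kappa \<pi> < real ?n - real ?f"
      using card_BK card_K K(2) AB by linarith
    \<comment> \<open>By FIFO delivery, no process in \<open>A\<close> contributes \<open>m'\<close> without contributing \<open>m\<close> before it.\<close>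
    have AX: "occurs_before (seg r k) m m'" if "k \<in> A" "m' \<in> set (seg r k)" for k
    proof (rule occurs_beforeI[OF that(2) neq])
      fix j assume j: "j < length (seg r k)" "seg r k ! j = m'"
      have k: "k \<in> Cor" "bc_before ?bc k m m'" using that(1) K(1) unfolding A_def by auto
      have j': "j < cut_at r k" "msg_at k j = m'" using j unfolding seg_def by auto
      then have "j < length (msgs (st \<rho> t p) k)" using len[of k] by simp
      then obtain j0 where "j0 < j" "msg_at k j0 = m"
        using bcch_fifo_msg_at[OF p k(1)] k(2) j'(2) by blast
      then show "\<exists>i'<j. seg r k ! i' = m"
        using j' unfolding seg_def by (intro exI[of _ j0]) simp
    qed
    \<comment> \<open>Stability of \<open>m'\<close> requires |X| to be at least (n + f -
      \<kappa>)/2, while \<open>bound\<close> keeps the rest of the processes below (n - f -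
      \<kappa>)/2.\<close>
    have "X \<inter> A \<noteq> {}"
    proof
      assume "X \<inter> A = {}"
      then have "X \<subseteq> B \<union> - K" using \<open>A \<union> B = K\<close> by blast
      then have "real (card X) \<le> real (card (B \<union> - K))" by (simp add: card_mono)
      moreover have "real (card X) \<ge> (real ?n + real ?f - kappa \<pi>) / 2"
        using round_batch_stable[OF select_in finite_pool batch, of m'] m'(1) nth_mem[OF m'(2)]
        unfolding C_count_def X_def by blast
      ultimately show False using bound of_nat_0_le_iff[of ?f, where 'a = real] by argo
    qed
    then obtain k where "k \<in> A" "m' \<in> set (seg r k)" unfolding X_def by blast
    then have "m \<in> set (seg r k)" using AX occurs_before_set by fast
    then have "m \<in> pool r D" using not_D unfolding pool_def by blast
    moreover have "m' \<in> pool r D"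
      using round_batch_disjoint(1)[OF select_in finite_pool batch] m' by fastforce
    \<comment> \<open>The second argument of the maximum alone yields the edge: the inequality
      amounts to 2|Y| + \<kappa> < n, and |Y| is controlled by \<open>bound\<close>.\<close>
    moreover have "real ?n - real ?f - real (M_count (seg r) m' m) >
        real (M_count (seg r) m' m) - real ?f + kappa \<pi>"
    proof -
      have "k \<notin> A" if "k \<in> Y" for k
        using AX[of k] occurs_before_asym[of "seg r k" m' m] occurs_before_set[of "seg r k" m' m] that
        unfolding Y_def by blast
      then have "Y \<subseteq> B \<union> - K" using \<open>A \<union> B = K\<close> by blast
      then have "real (M_count (seg r) m' m) \<le> real (card (B \<union> - K))"
        unfolding M_count_def Y_def by (simp add: card_mono)
      then show ?thesis using bound of_nat_0_le_iff[of ?f, where 'a = real] by argo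
    qed
    ultimately have "(m, m') \<in> order_edges ?f (kappa \<pi>) (seg r) (pool r D)"
      using neq unfolding order_edges_def by simp
    then show False
      using round_batch_order[OF select_in finite_pool batch m'(2,1)] not_batch by blast
  qed
  then show ?thesis unfolding of_differential_order_fairness_def by blast
qed

end

section \<open>Progress of rounds and agreement\<close>

text \<open>The list may have grown from the requested position \<open>a\<close> to \<open>c\<close>
  while the answer was under way. The overlap is skipped and the answer still fills the list up to
  \<open>d\<close>.\<close>

lemma length_get_messages_resend_list:
  "a \<le> c \<Longrightarrow> c \<le> d \<Longrightarrow> length (get_messages k c (resend_list k xs a d)) = d - c"
proof (induction "d - a" arbitrary: a c)
  case 0
  then show ?case by (simp add: resend_list_def)
next
  case (Suc n)
  then have "a < d" by simp
  then have *: "resend_list k xs a d = (k, Suc a, xs ! a) # resend_list k xs (Suc a) d"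
    by (simp add: resend_list_def upt_conv_Cons)
  show ?case
  proof (cases "a = c")
    case True
    moreover have "length (get_messages k (Suc c) (resend_list k xs (Suc a) d)) = d - Suc c"
      using Suc.hyps \<open>a < d\<close> True by (intro Suc.hyps(1)) auto
    ultimately show ?thesis unfolding * using \<open>a < d\<close> by (simp add: Suc_diff_Suc)
  next
    case False
    then have "length (get_messages k c (resend_list k xs (Suc a) d)) = d - c"
      using Suc.hyps(2) Suc.prems by (intro Suc.hyps(1)) auto
    then show ?thesis unfolding * using False by simp
  qed
qed

text \<open>The greatest element exists: the value 0 qualifies because all n > f entries reach it,
  and no value above the column maximum does.\<close>

lemma cut_of_le:
  fixes L :: "'p::finite \<Rightarrow> 'p \<Rightarrow> nat"
  assumes "f < CARD('p)"
  obtains i where "cut_of f L j \<le> L i j"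
proof -
  let ?P = "\<lambda>s. f + 1 \<le> card {i. s \<le> L i j}"
  have ex: "\<exists>i. s \<le> L i j" if "?P s" for s
  proof -
    have "{i. s \<le> L i j} \<noteq> {}" using that by (intro notI) simp
    then show ?thesis by blast
  qed
  have bounded: "s \<le> Max (range (\<lambda>i. L i j))" if s: "?P s" for s
  proof -
    obtain i where "s \<le> L i j" using ex[OF s] by blast
    also have "\<dots> \<le> Max (range (\<lambda>i. L i j))" by simp
    finally show ?thesis .
  qed
  have "?P 0" using assms by simp
  then have "?P (cut_of f L j)" unfolding cut_of_def using bounded by (rule GreatestI_nat)
  then show ?thesis using ex that by blast
qed

lemma cut_of_ge:
  fixes L :: "'p::finite \<Rightarrow> 'p \<Rightarrow> nat"
  assumes "f < card {i. s \<le> L i j}"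
  shows "s \<le> cut_of f L j"
  unfolding cut_of_def
proof (rule Greatest_le_nat)
  show "f + 1 \<le> card {i. s \<le> L i j}" using assms by simp
next
  fix s' assume "f + 1 \<le> card {i. s' \<le> L i j}"
  then have "{i. s' \<le> L i j} \<noteq> {}" by (intro notI) simp
  then obtain i where "s' \<le> L i j" by blast
  also have "\<dots> \<le> Max (range (\<lambda>i. L i j))" by simp
  finally show "s' \<le> Max (range (\<lambda>i. L i j))" .
qed

fun handler_of :: "'p \<Rightarrow> ('p, 'sig, 'str) msg \<Rightarrow> ('p, 'm, 'sig, 'str) action" where
  "handler_of q (STATUS r v \<sigma>) = HandleStatus q r v \<sigma>"
| "handler_of q (MISSING r k i) = HandleMissing q r k i"
| "handler_of q (RESEND r k s) = HandleResend q r k s"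

lemma handler_handler_of: "handler (handler_of q \<mu>)"
  by (cases \<mu>) auto

lemma lstep_inbox:
  assumes "lstep \<pi> p a s s' out" "x \<in> inbox s" "a \<noteq> handler_of (fst x) (snd x)"
  shows "x \<in> inbox s'"
  using assms by cases auto

section \<open>Message transport and fair handlers\<close>

context ofab_execution
begin

lemma link_step:
  assumes "q \<in> Cor"
  obtains zs where "link \<rho> (Suc t) q p =
    (if \<exists>\<mu>. ev \<rho> t = Some (p, Receive q \<mu>) then tl (link \<rho> t q p) else link \<rho> t q p) @ zs"
proof (cases "ev \<rho> t")
  case None
  then show ?thesis using no_event_step that[of "[]"] by simp
next
  case (Some e)
  obtain p' a where e: "ev \<rho> t = Some (p', a)" using Some by (cases e) auto
  obtain out where "link \<rho> (Suc t) =
       (\<lambda>x y. in_transit Cor p' a (link \<rho> t) x y @ (if x = p' then out y else []))"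
    by (rule event_step[OF e]) blast
  moreover have "in_transit Cor p' a (link \<rho> t) q p =
      (if \<exists>\<mu>. ev \<rho> t = Some (p, Receive q \<mu>) then tl (link \<rho> t q p) else link \<rho> t q p)"
    using e assms unfolding in_transit_def by (cases a) auto
  ultimately show ?thesis using that[of "if q = p' then out p else []"] by simp
qed

text \<open>Induction on the number of messages queued ahead. Up to the first receive event the
  queue only grows at its end, so its head is unchanged; that event then removes one
  message.\<close>

lemma link_received:
  assumes p: "p \<in> Cor" and q: "q \<in> Cor"
  shows "link \<rho> t q p = xs @ \<mu> # ys \<Longrightarrow> \<exists>t'\<ge>t. ev \<rho> t' = Some (p, Receive q \<mu>)"
proof (induction xs arbitrary: t ys)
  have wait: "\<exists>t'\<ge>t. \<exists>\<nu> zs. ev \<rho> t' = Some (p, Receive q \<nu>) \<and> link \<rho> t' q p = link \<rho> t q p @ zs"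
    if nonempty: "link \<rho> t q p \<noteq> []" for t
  proof -
    let ?P = "\<lambda>d. \<exists>\<nu>. ev \<rho> (t + d) = Some (p, Receive q \<nu>)"
    obtain t' \<nu> where "t' \<ge> t" "ev \<rho> t' = Some (p, Receive q \<nu>)"
      using fair p q nonempty unfolding fair_run_def by blast
    then have "\<exists>d. ?P d" by (intro exI[of _ "t' - t"]) auto
    then obtain d where d: "?P d" "\<forall>d'<d. \<not> ?P d'" using exists_least_iff[of ?P] by blast
    have "\<exists>zs. link \<rho> (t + d') q p = link \<rho> t q p @ zs" if "d' \<le> d" for d'
      using that
    proof (induction d')
      case (Suc d')
      then obtain zs where zs: "link \<rho> (t + d') q p = link \<rho> t q p @ zs" by auto
      have none: "\<not> ?P d'" using d(2) Suc.prems by simp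
      show ?case
        by (rule link_step[OF q, of "t + d'" p]) (use zs none in simp)
    qed simp
    then obtain zs where "link \<rho> (t + d) q p = link \<rho> t q p @ zs" by blast
    then show ?thesis using d(1) by (intro exI[of _ "t + d"]) auto
  qed
  {
    case Nil
    then obtain t' \<nu> zs where t': "t' \<ge> t" "ev \<rho> t' = Some (p, Receive q \<nu>)"
      "link \<rho> t' q p = (\<mu> # ys) @ zs" using wait[of t] by auto
    have "hd (link \<rho> t' q p) = \<nu>" by (rule event_step[OF t'(2)]) (use q in blast)
    then have "\<nu> = \<mu>" using t'(3) by simp
    then show ?case using t' by blast
  next
    case (Cons x xs)
    then obtain t' \<nu> zs where t': "t' \<ge> t" "ev \<rho> t' = Some (p, Receive q \<nu>)"
      "link \<rho> t' q p = (x # xs @ \<mu> # ys) @ zs" using wait[of t] by auto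
    obtain zs' where "link \<rho> (Suc t') q p = xs @ \<mu> # (ys @ zs @ zs')"
      by (rule link_step[OF q, of t' p]) (use t'(2,3) in auto)
    then obtain t'' where "t'' \<ge> Suc t'" "ev \<rho> t'' = Some (p, Receive q \<mu>)"
      using Cons.IH by blast
    then show ?case using t'(1) by (intro exI[of _ t'']) simp
  }
qed

lemma sent_received:
  assumes "ev \<rho> t = Some (q, a)" "p \<in> Cor"
    and sent: "\<And>s' out. lstep \<pi> q a (st \<rho> t q) s' out \<Longrightarrow> \<mu> \<in> set (out p)"
  obtains t' where "t' > t" "(q, \<mu>) \<in> inbox (st \<rho> t' p)"
proof -
  obtain out where q: "q \<in> Cor" and out: "lstep \<pi> q a (st \<rho> t q) (st \<rho> (Suc t) q) out"
    "link \<rho> (Suc t) = (\<lambda>x y. in_transit Cor q a (link \<rho> t) x y @ (if x = q then out y else []))"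
    by (rule event_step[OF assms(1)]) blast
  then have "\<mu> \<in> set (link \<rho> (Suc t) q p)" using sent[OF out(1)] by simp
  then obtain xs ys where "link \<rho> (Suc t) q p = xs @ \<mu> # ys" by (meson split_list)
  then obtain t' where t': "t' \<ge> Suc t" "ev \<rho> t' = Some (p, Receive q \<mu>)"
    using link_received[OF assms(2) q] by blast
  obtain out' where "lstep \<pi> p (Receive q \<mu>) (st \<rho> t' p) (st \<rho> (Suc t') p) out'"
    by (rule event_step[OF t'(2)]) blast
  then have "(q, \<mu>) \<in> inbox (st \<rho> (Suc t') p)" by cases auto
  then show ?thesis using that[of "Suc t'"] t'(1) by simp
qed

lemma handler_fires:
  assumes "p \<in> Cor" "handler a" "\<And>t. t \<ge> T \<Longrightarrow> \<exists>s' out. lstep \<pi> p a (st \<rho> t p) s' out"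
  obtains t out where "t \<ge> T" "ev \<rho> t = Some (p, a)"
    "lstep \<pi> p a (st \<rho> t p) (st \<rho> (Suc t) p) out"
proof -
  obtain t where "t \<ge> T" "ev \<rho> t = Some (p, a)"
    using fair assms unfolding fair_run_def by blast
  then show ?thesis using that by (meson event_step)
qed

text \<open>Only its own handler removes a message from the inbox. If that never happened, the
  handler would be enabled forever from some time on, and fairness would execute it.\<close>

lemma message_handled:
  assumes p: "p \<in> Cor" and inbox: "(q, \<mu>) \<in> inbox (st \<rho> t0 p)"
    and enabled: "\<And>t. t \<ge> T \<Longrightarrow> (q, \<mu>) \<in> inbox (st \<rho> t p) \<Longrightarrow>
      \<exists>s' out. lstep \<pi> p (handler_of q \<mu>) (st \<rho> t p) s' out"
  obtains t out where "t \<ge> t0" "ev \<rho> t = Some (p, handler_of q \<mu>)"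
    "lstep \<pi> p (handler_of q \<mu>) (st \<rho> t p) (st \<rho> (Suc t) p) out"
proof -
  have "\<exists>t\<ge>t0. ev \<rho> t = Some (p, handler_of q \<mu>)"
  proof (rule ccontr)
    assume never: "\<not> ?thesis"
    have stays: "(q, \<mu>) \<in> inbox (st \<rho> t p)" if "t \<ge> t0" for t
      using that
    proof (induction rule: dec_induct)
      case (step t)
      show ?case
      proof (rule state_step_cases[of t p])
        fix a out assume "ev \<rho> t = Some (p, a)" "lstep \<pi> p a (st \<rho> t p) (st \<rho> (Suc t) p) out"
        then show ?thesis using never step lstep_inbox[of \<pi> p a _ _ out "(q, \<mu>)"] by fastforce
      qed (use step in simp)
    qed (rule inbox)
    obtain t where "t \<ge> max t0 T" "ev \<rho> t = Some (p, handler_of q \<mu>)"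
      using handler_fires[OF p handler_handler_of[of q \<mu>], of "max t0 T"] enabled stays by force
    then show False using never by simp
  qed
  then show ?thesis using that by (meson event_step)
qed

lemma finish_round_enabled:
  assumes "cuts s (rnd s) \<noteq> None" "\<forall>j. cut s j \<le> length (msgs s j)"
  shows "\<exists>s' out. lstep \<pi> p FinishRound s s' out"
proof -
  define ls where "ls = (\<lambda>j. take (cut s j) (msgs s j))"
  define V where "V = (\<Union>j. set (ls j)) - delivered s"
  have "finite V" unfolding V_def by simp
  then obtain ws where "round_batch (faults \<pi>) (kappa \<pi>) (select \<pi>) ls V ws"
    using round_batch_ex1[OF select_in] by blast
  then show ?thesis
    using lstep.finish_round[OF assms ls_def V_def] unfolding round_batch_def by blast
qed

section \<open>Progress of rounds\<close>

lemma decision_persists: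
  assumes "t \<le> t'" "decision (st \<rho> t p) r \<noteq> None"
  shows "decision (st \<rho> t' p) r \<noteq> None"
  using assms
proof (induction rule: dec_induct)
  case (step t)
  show ?case
  proof (rule state_step_cases[of t p])
    fix a out assume "lstep \<pi> p a (st \<rho> t p) (st \<rho> (Suc t) p) out"
    then show ?thesis using step by cases auto
  qed (use step in simp)
qed

lemma decided_everywhere:
  assumes "vbc_decided r v" "p \<in> Cor"
  obtains T where "\<And>t. t \<ge> T \<Longrightarrow> decision (st \<rho> t p) r = Some v"
proof -
  obtain t v' where t: "ev \<rho> t = Some (p, VbcDecide r v')"
    using consensus assms unfolding validated_consensus_def vbc_termination_def vbc_decided_def
      vbc_decides_def by meson
  obtain out where "lstep \<pi> p (VbcDecide r v') (st \<rho> t p) (st \<rho> (Suc t) p) out"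
    by (rule event_step[OF t]) blast
  then have "decision (st \<rho> (Suc t) p) r \<noteq> None" by cases auto
  then have "decision (st \<rho> t' p) r = Some v" if "t' \<ge> Suc t" for t'
    using decision_persists[OF that] decision_decided[OF assms(2)] vbc_decided_unique assms(1)
    by (metis not_None_eq)
  then show ?thesis using that by blast
qed

text \<open>A process cannot leave round \<open>r\<close> without a recorded cut. While none is
  recorded it is stuck in \<open>r\<close>, and once the decision has arrived,
  \<open>HandleDecide\<close> stays enabled.\<close>

lemma cut_determined:
  assumes dec: "vbc_decided r v" and r: "1 \<le> r" and p: "p \<in> Cor"
    and reach: "\<exists>t. r \<le> rnd (st \<rho> t p)"
  obtains T where "\<And>t. t \<ge> T \<Longrightarrow> cuts (st \<rho> t p) r = Some (cut_at r) \<and> r \<le> rnd (st \<rho> t p)"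
proof -
  obtain t0 where t0: "r \<le> rnd (st \<rho> t0 p)" using reach by blast
  have "\<exists>t. cuts (st \<rho> t p) r \<noteq> None"
  proof (rule ccontr)
    assume "\<not> ?thesis"
    then have none: "cuts (st \<rho> t p) r = None" for t by blast
    then have le: "rnd (st \<rho> t p) \<le> r" for t using finished_round[OF p r, of t] by force
    have rnd: "rnd (st \<rho> t p) = r" if "t \<ge> t0" for t
      using le[of t] state_mono(2)[OF that, of p] t0 by simp
    obtain T where T: "\<And>t. t \<ge> T \<Longrightarrow> decision (st \<rho> t p) r = Some v"
      using decided_everywhere[OF dec p] by blast
    have enabled: "\<exists>s' out. lstep \<pi> p HandleDecide (st \<rho> t p) s' out" if "t \<ge> max t0 T" for t
    proof -
      obtain js where "distinct js"
        "set js = {j. vc (st \<rho> t p) j < cut_of (faults \<pi>) (fst v) j}"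
        using finite_distinct_list[of "{j. vc (st \<rho> t p) j < cut_of (faults \<pi>) (fst v) j}"]
        by auto
      then show ?thesis
        using lstep.handle_decide[of "st \<rho> t p" "fst v" "snd v"] T[of t] rnd[of t] none[of t] that
        by fastforce
    qed
    obtain t out where "t \<ge> max t0 T"
      "lstep \<pi> p HandleDecide (st \<rho> t p) (st \<rho> (Suc t) p) out"
      by (rule handler_fires[OF p, of HandleDecide "max t0 T"]) (simp, (use enabled in blast)+)
    then have "cuts (st \<rho> (Suc t) p) r \<noteq> None" using rnd[of t] by (auto elim: lstep.cases)
    then show False using none by simp
  qed
  then obtain t1 where "cuts (st \<rho> t1 p) r = Some (cut_at r)"
    using cuts_decided[OF p] by fastforce
  then show ?thesis
    using that[of "max t0 t1"] state_mono(3)[of t1 _ p r] state_mono(2)[of t0 _ p] t0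
    by (meson max.bounded_iff order_trans)
qed

text \<open>Recovers the moment at which the requests for missing messages of round \<open>r\<close>
  were sent.\<close>

lemma cuts_handle_decide:
  assumes p: "p \<in> Cor"
  shows "cuts (st \<rho> t p) r = Some c \<Longrightarrow>
    \<exists>t'<t. ev \<rho> t' = Some (p, HandleDecide) \<and> rnd (st \<rho> t' p) = r"
  using p
proof (induction t rule: state_induct)
  case (step t a out)
  from step.hyps(2) have "cuts (st \<rho> t p) r = Some c \<or> a = HandleDecide \<and> rnd (st \<rho> t p) = r"
    using step.prems by cases (auto split: if_splits)
  then show ?case using step.IH step.hyps(1) less_Suc_eq by blast
qed (auto simp: init_state_def less_Suc_eq)

text \<open>If \<open>q\<close> never left round \<open>r\<close>, fairness would carry every
  request for missing messages to a holder and its answer back, after which the round can finish. By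
  \<open>avail\<close> there is a holder for each sender separately, not necessarily one for
  all.\<close>

lemma round_progress:
  assumes dec: "vbc_decided r v" and r: "1 \<le> r"
    and reach: "\<And>p. p \<in> Cor \<Longrightarrow> \<exists>t. r \<le> rnd (st \<rho> t p)"
    and avail: "\<And>k. \<exists>p\<in>Cor. \<exists>t. cut_at r k \<le> length (msgs (st \<rho> t p) k)"
    and q: "q \<in> Cor"
  shows "\<exists>t. Suc r \<le> rnd (st \<rho> t q)"
proof (rule ccontr)
  assume "\<not> ?thesis"
  then have le: "rnd (st \<rho> t q) \<le> r" for t by (metis not_less_eq_eq)
  obtain T0 where T0: "\<And>t. t \<ge> T0 \<Longrightarrow> cuts (st \<rho> t q) r = Some (cut_at r) \<and> r \<le> rnd (st \<rho> t q)"
    using cut_determined[OF dec r q reach[OF q]] by blast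
  have rnd: "rnd (st \<rho> t q) = r" if "t \<ge> T0" for t using T0[OF that] le[of t] by simp
  have cut: "cut (st \<rho> t q) = cut_at r" if "t \<ge> T0" for t
    using current_cut[OF q, of t] T0[OF that] rnd[OF that] by simp
  have "\<exists>t. cut_at r k \<le> length (msgs (st \<rho> t q) k)" for k
  proof (rule ccontr)
    assume "\<not> ?thesis"
    then have lacks: "length (msgs (st \<rho> t q) k) < cut_at r k" for t by (simp add: not_le)
    obtain t1 where t1: "ev \<rho> t1 = Some (q, HandleDecide)" "rnd (st \<rho> t1 q) = r"
      using cuts_handle_decide[OF q] T0[of T0] by blast
    \<comment> \<open>The position named in the request; by the time the answer is handled,
      \<open>q\<close> may have more messages from \<open>k\<close>.\<close>
    define idx where "idx = length (msgs (st \<rho> t1 q) k)"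
    obtain p t2 where p: "p \<in> Cor" and t2: "cut_at r k \<le> length (msgs (st \<rho> t2 p) k)"
      using avail by blast
    have "MISSING r k idx \<in> set (out p)" if "lstep \<pi> q HandleDecide (st \<rho> t1 q) s' out" for s' out
      using that
    proof cases
      case (handle_decide L' \<Sigma>' c js)
      then have "c = cut_at r"
        using decision_decided[OF q] cut_at_decided t1(2) by fastforce
      then have "k \<in> set js" using handle_decide lacks vc_eq_length[OF q] by simp
      then show ?thesis
        using handle_decide t1(2) vc_eq_length[OF q] unfolding idx_def by (auto intro: image_eqI)
    qed
    then obtain t3 where t3: "t3 > t1" "(q, MISSING r k idx) \<in> inbox (st \<rho> t3 p)"
      using sent_received[OF t1(1) p] by blast
    obtain T1 where T1: "\<And>t. t \<ge> T1 \<Longrightarrow> cuts (st \<rho> t p) r = Some (cut_at r) \<and> r \<le> rnd (st \<rho> t p)"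
      using cut_determined[OF dec r p reach[OF p]] by blast
    have "\<exists>s' out. lstep \<pi> p (handler_of q (MISSING r k idx)) (st \<rho> t p) s' out"
      if "t \<ge> max T1 t2" "(q, MISSING r k idx) \<in> inbox (st \<rho> t p)" for t
    proof -
      have "cut_at r k \<le> vc (st \<rho> t p) k"
        using t2 length_msgs_mono[of t2 t p k] that(1) vc_eq_length[OF p, of t k] by simp
      then show ?thesis
        using lstep.handle_missing[OF that(2)] T1[of t] that(1) by fastforce
    qed
    then obtain t4 out4 where t4: "t4 \<ge> t3" "ev \<rho> t4 = Some (p, HandleMissing q r k idx)"
      using message_handled[OF p t3(2)] by (metis handler_of.simps(2))
    define s where "s = create_proof \<pi> (resend_list k (msgs (st \<rho> t4 p) k) idx (cut_at r k))"
    have "RESEND r k s \<in> set (out q)"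
      if "lstep \<pi> p (HandleMissing q r k idx) (st \<rho> t4 p) s' out" for s' out
      using that
    proof cases
      case (handle_missing c)
      then have "c = cut_at r" using cuts_decided[OF p] by blast
      then show ?thesis using handle_missing unfolding s_def by simp
    qed
    then obtain t5 where t5: "t5 > t4" "(p, RESEND r k s) \<in> inbox (st \<rho> t5 q)"
      using sent_received[OF t4(2) q] by blast
    have "\<exists>s' out. lstep \<pi> q (handler_of p (RESEND r k s)) (st \<rho> t q) s' out"
      if "t \<ge> T0" "(p, RESEND r k s) \<in> inbox (st \<rho> t q)" for t
      using lstep.handle_resend[OF that(2)] rnd[OF that(1)] cut[OF that(1)] lacks[of t] by fastforce
    then obtain t6 out6 where t6: "t6 \<ge> t5"
      "lstep \<pi> q (HandleResend p r k s) (st \<rho> t6 q) (st \<rho> (Suc t6) q) out6"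
      using message_handled[OF q t5(2)] by (metis handler_of.simps(3))
    let ?len = "length (msgs (st \<rho> t6 q) k)"
    have "idx \<le> ?len"
      unfolding idx_def using length_msgs_mono[of t1 t6 q k] t3(1) t4(1) t5(1) t6(1) by simp
    then have "length (get_messages k ?len (proof_contents \<pi> s)) = cut_at r k - ?len"
      using params lacks[of t6] unfolding s_def params_ok_def
      by (simp add: length_get_messages_resend_list)
    moreover have "verify_proof \<pi> s" using params unfolding s_def params_ok_def by simp
    ultimately have "length (msgs (st \<rho> (Suc t6) q) k) = cut_at r k"
      using t6(2) lacks[of t6] by (auto elim!: lstep.cases)
    then show False using lacks[of "Suc t6"] by simp
  qed
  \<comment> \<open>Lists only grow and there are finitely many senders, so one time serves for all
    of them.\<close>
  then have "\<forall>k. \<forall>\<^sub>F t in sequentially. cut_at r k \<le> length (msgs (st \<rho> t q) k)"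
    unfolding eventually_sequentially using length_msgs_mono order_trans by meson
  then have "\<forall>\<^sub>F t in sequentially. \<forall>k. cut_at r k \<le> length (msgs (st \<rho> t q) k)"
    by (intro eventually_all_finite) simp
  then obtain T1 where T1: "\<And>t k. t \<ge> T1 \<Longrightarrow> cut_at r k \<le> length (msgs (st \<rho> t q) k)"
    unfolding eventually_sequentially by blast
  have enabled: "\<exists>s' out. lstep \<pi> q FinishRound (st \<rho> t q) s' out" if "t \<ge> max T0 T1" for t
    using that T0[of t] T1[of t] rnd[of t] cut[of t] by (intro finish_round_enabled) auto
  obtain t out where "t \<ge> max T0 T1" "lstep \<pi> q FinishRound (st \<rho> t q) (st \<rho> (Suc t) q) out"
    by (rule handler_fires[OF q, of FinishRound "max T0 T1"]) (simp, (use enabled in blast)+)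
  then have "rnd (st \<rho> (Suc t) q) = Suc r" using rnd[of t] by (auto elim!: lstep.cases)
  then show False using le[of "Suc t"] by simp
qed

text \<open>Induction on the round: having finished it, \<open>p\<close> itself is the holder that
  \<open>round_progress\<close> requires for every sender.\<close>

lemma rounds_reached:
  assumes p: "p \<in> Cor"
  shows "r \<le> rnd (st \<rho> t p) \<Longrightarrow> q \<in> Cor \<Longrightarrow> \<exists>t'. r \<le> rnd (st \<rho> t' q)"
proof (induction r arbitrary: q)
  case (Suc r)
  show ?case
  proof (cases "r = 0")
    case True
    then show ?thesis using rnd_pos[OF Suc.prems(2)] by auto
  next
    case False
    then have fin: "cuts (st \<rho> t p) r = Some (cut_at r)"
      "\<And>k. cut_at r k \<le> length (msgs (st \<rho> t p) k)"
      using finished_round[OF p, of r t] Suc.prems(1) by auto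
    obtain v where "vbc_decided r v" using cuts_decided[OF p fin(1)] by blast
    then show ?thesis
      using False Suc.IH Suc.prems fin(2) p by (intro round_progress[of r v q]) auto
  qed
qed simp

lemma agreement: "of_agreement Cor (of_log \<rho>)"
proof -
  have "of_delivers (of_log \<rho>) q m"
    if p: "p \<in> Cor" and q: "q \<in> Cor" and m: "of_delivers (of_log \<rho>) p m" for p q m
  proof -
    obtain t where "m \<in> \<Union> (set (rlog (rnd (st \<rho> t p))))"
      using m of_log_eq_rlog[OF p] unfolding of_delivers_def by metis
    moreover obtain t' where "rnd (st \<rho> t p) \<le> rnd (st \<rho> t' q)"
      using rounds_reached[OF p order_refl q] by blast
    ultimately have "m \<in> \<Union> (set (of_log \<rho> t' q))"
      unfolding of_log_eq_rlog[OF q] using set_mono_prefix[OF rlog_mono] by blast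
    then show ?thesis unfolding of_delivers_def by blast
  qed
  then show ?thesis unfolding of_agreement_def by blast
qed

end

section \<open>Weak validity\<close>

lemma set_in_transit: "set (in_transit Cor p a lk x y) \<subseteq> set (lk x y)"
  unfolding in_transit_def by (cases a; cases "lk x y"; auto)

context ofab_execution
begin

section \<open>The origin of the rows of a decided matrix\<close>

definition round_start :: "'p \<Rightarrow> nat \<Rightarrow> nat \<Rightarrow> bool" where
  "round_start q t r \<longleftrightarrow> ev \<rho> t = Some (q, StartRound) \<and> rnd (st \<rho> t q) = r"

text \<open>Shows in particular that a signed clock is nonzero, which distinguishes it from a row
  that still has its reset value.\<close>

lemma round_start_new_message:
  assumes "round_start q t r"
  shows "\<exists>k. cut (st \<rho> t q) k < vc (st \<rho> t q) k"
proof -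
  have e: "ev \<rho> t = Some (q, StartRound)" using assms unfolding round_start_def by blast
  obtain out where q: "q \<in> Cor" and step: "lstep \<pi> q StartRound (st \<rho> t q) (st \<rho> (Suc t) q) out"
    by (rule event_step[OF e]) blast
  from step show "\<exists>k. cut (st \<rho> t q) k < vc (st \<rho> t q) k"
    by cases (simp add: vc_eq_length[OF q])
qed

lemma status_in_transit:
  assumes q: "q \<in> Cor"
  shows "STATUS r v \<sigma> \<in> set (link \<rho> t q p) \<Longrightarrow> \<exists>t'<t. round_start q t' r \<and> vc (st \<rho> t' q) = v"
proof (induction t)
  case 0
  then show ?case using link_init by simp
next
  case (Suc t)
  show ?case
  proof (cases "STATUS r v \<sigma> \<in> set (link \<rho> t q p)")
    case True
    then show ?thesis using Suc.IH less_Suc_eq by blast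
  next
    case False
    have "\<exists>a. ev \<rho> t = Some (q, a)"
    proof (rule ccontr)
      assume no: "\<not> ?thesis"
      show False
      proof (cases "ev \<rho> t")
        case None
        then show False using no_event_step[of t] Suc.prems False by simp
      next
        case (Some e)
        obtain p' a where e: "ev \<rho> t = Some (p', a)" using Some by (cases e) auto
        then have "p' \<noteq> q" using no by blast
        moreover obtain out where "link \<rho> (Suc t) =
            (\<lambda>x y. in_transit Cor p' a (link \<rho> t) x y @ (if x = p' then out y else []))"
          by (rule event_step[OF e]) blast
        ultimately show False
          using Suc.prems False set_in_transit[of Cor p' a "link \<rho> t" q p] by auto
      qed
    qed
    then obtain a where e: "ev \<rho> t = Some (q, a)" by blast
    obtain out where step: "lstep \<pi> q a (st \<rho> t q) (st \<rho> (Suc t) q) out" and link: "link \<rho> (Suc t) =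
        (\<lambda>x y. in_transit Cor q a (link \<rho> t) x y @ (if x = q then out y else []))"
      by (rule event_step[OF e]) blast
    have sent: "STATUS r v \<sigma> \<in> set (out p)"
      using Suc.prems False link set_in_transit[of Cor q a "link \<rho> t" q p] by auto
    from step have "a = StartRound \<and> rnd (st \<rho> t q) = r \<and> vc (st \<rho> t q) = v"
      using sent by cases (auto simp: no_output_def split: if_splits)
    then show ?thesis using e unfolding round_start_def by blast
  qed
qed

text \<open>The matrix is cleared at the end of each round and only \<open>STATUS\<close> messages
  of the current round are accepted. The authenticated link, rather than the signature, ties the row
  to a round start of \<open>q\<close> in this very round.\<close>

lemma Lmat_row:
  assumes p: "p \<in> Cor" and q: "q \<in> Cor"
  shows "Lmat (st \<rho> t p) q = (\<lambda>_. 0) \<or>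
    (\<exists>t'. round_start q t' (rnd (st \<rho> t p)) \<and> vc (st \<rho> t' q) = Lmat (st \<rho> t p) q)"
  using p
proof (induction t rule: state_induct)
  case (step t a out)
  from step.hyps(2) show ?case
  proof cases
    case (handle_status q' r' v' \<sigma>')
    show ?thesis
    proof (cases "q' = q")
      case True
      obtain t1 where t1: "ev \<rho> t1 = Some (p, Receive q (STATUS r' v' \<sigma>'))"
        using inbox_received[OF p] handle_status True by blast
      have "link \<rho> t1 q p \<noteq> [] \<and> hd (link \<rho> t1 q p) = STATUS r' v' \<sigma>'"
        by (rule event_step[OF t1]) (use q in blast)
      then have "STATUS r' v' \<sigma>' \<in> set (link \<rho> t1 q p)" by (metis hd_in_set)
      then show ?thesis using status_in_transit[OF q] handle_status True by fastforce
    qed (use step.IH handle_status in auto)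
  qed (use step.IH in auto)
qed (simp_all add: init_state_def)

text \<open>The decided matrix was proposed, so it is the matrix of some correct process. Its valid
  signatures number at least n - f, and n > 3f makes this more than f.\<close>

lemma all_correct_decision:
  assumes all: "Cor = UNIV" and dec: "vbc_decided r v"
  shows "fst v i = (\<lambda>_. 0) \<or> (\<exists>t. round_start i t r \<and> vc (st \<rho> t i) = fst v i)"
    and "faults \<pi> < card {i. \<exists>t. round_start i t r \<and> vc (st \<rho> t i) = fst v i}"
proof -
  obtain p t where d: "ev \<rho> t = Some (p, VbcDecide r v)" "p \<in> Cor"
    using dec unfolding vbc_decided_def vbc_decides_def by blast
  then obtain t' q where "vbc_proposes \<rho> t' q r v"
    using consensus all
    unfolding validated_consensus_def vbc_external_validity_def vbc_decides_def by meson
  then have proposed: "r = rnd (st \<rho> t' q)" "fst v = Lmat (st \<rho> t' q)"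
    unfolding vbc_proposes_def by auto
  have rows: "fst v i = (\<lambda>_. 0) \<or> (\<exists>t. round_start i t r \<and> vc (st \<rho> t i) = fst v i)" for i
    unfolding proposed using Lmat_row[of q i t'] all by simp
  show "fst v i = (\<lambda>_. 0) \<or> (\<exists>t. round_start i t r \<and> vc (st \<rho> t i) = fst v i)" by (rule rows)
  define J where "J = {j. \<exists>\<sigma>. snd v j = Some \<sigma> \<and> verifysig \<pi> j (fst v j) \<sigma>}"
  have "vbc_predicate \<pi> v"
    using consensus d unfolding validated_consensus_def vbc_external_validity_def vbc_decides_def
    by blast
  then have J: "CARD('p) - faults \<pi> \<le> card J" unfolding vbc_predicate_def J_def .
  \<comment> \<open>Signatures do not mention the round, but a clock is signed only when it is nonzero, and the
    nonzero rows of a proposal stem from the current round.\<close>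
  have "\<exists>t. round_start i t r \<and> vc (st \<rho> t i) = fst v i" if i: "i \<in> J" for i
  proof -
    have "signed_before \<rho> t i (fst v i)"
    proof -
      obtain L' \<Sigma>' where v: "v = (L', \<Sigma>')" by (cases v)
      have "i \<in> Cor" using all by simp
      then show ?thesis
        using secure d(1) i unfolding signatures_secure_def J_def v fst_conv snd_conv by blast
    qed
    then obtain u where "ev \<rho> u = Some (i, StartRound)" "vc (st \<rho> u i) = fst v i"
      unfolding signed_before_def by blast
    moreover from this obtain k where "cut (st \<rho> u i) k < vc (st \<rho> u i) k"
      using round_start_new_message[of i u "rnd (st \<rho> u i)"] unfolding round_start_def by blast
    ultimately have "fst v i k \<noteq> 0" by simp
    then show ?thesis using rows[of i] by auto
  qed
  then have "J \<subseteq> {i. \<exists>t. round_start i t r \<and> vc (st \<rho> t i) = fst v i}" by blast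
  then have "card J \<le> card {i. \<exists>t. round_start i t r \<and> vc (st \<rho> t i) = fst v i}"
    by (simp add: card_mono)
  then show "faults \<pi> < card {i. \<exists>t. round_start i t r \<and> vc (st \<rho> t i) = fst v i}"
    using J resilience by linarith
qed

text \<open>The cut is bounded by an entry of some row, and the owner of a nonzero row had that many
  messages when it signed. This gives \<open>avail\<close> in \<open>round_progress\<close> before
  any process has finished the round.\<close>

lemma all_correct_cut_available:
  assumes all: "Cor = UNIV" and dec: "vbc_decided r v"
  shows "\<exists>p\<in>Cor. \<exists>t. cut_at r k \<le> length (msgs (st \<rho> t p) k)"
proof -
  obtain i where i: "cut_at r k \<le> fst v i k"
    using cut_of_le[of "faults \<pi>" "fst v" k] resilience unfolding cut_at_decided[OF dec] by auto
  show ?thesis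
  proof (cases "fst v i = (\<lambda>_. 0)")
    case True
    then show ?thesis using i all by auto
  next
    case False
    then obtain t where "vc (st \<rho> t i) = fst v i" using all_correct_decision(1)[OF all dec] by blast
    then show ?thesis using i vc_eq_length[of i t k] all by auto
  qed
qed

text \<open>More than f rows are clocks signed at the start of round \<open>r\<close>, and the cut
  dominates any common lower bound of more than f entries of a column.\<close>

lemma all_correct_cut_ge:
  assumes all: "Cor = UNIV" and dec: "vbc_decided r v"
    and low: "\<And>i t. round_start i t r \<Longrightarrow> b \<le> vc (st \<rho> t i) k"
  shows "b \<le> cut_at r k"
proof -
  have "{i. \<exists>t. round_start i t r \<and> vc (st \<rho> t i) = fst v i} \<subseteq> {i. b \<le> fst v i k}"
    using low by fastforce
  then have "card {i. \<exists>t. round_start i t r \<and> vc (st \<rho> t i) = fst v i} \<le> card {i. b \<le> fst v i k}"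
    by (simp add: card_mono)
  then show ?thesis
    unfolding cut_at_decided[OF dec]
    using all_correct_decision(2)[OF all dec] by (intro cut_of_ge) simp
qed

lemma inround_started:
  assumes p: "p \<in> Cor"
  shows "inround (st \<rho> t p) \<Longrightarrow> \<exists>t'. round_start p t' (rnd (st \<rho> t p))"
  using p
proof (induction t rule: state_induct)
  case (step t a out)
  from step.hyps(2) show ?case
  proof cases
    case start_round
    then show ?thesis using step.hyps(1) unfolding round_start_def by auto
  qed (use step.IH step.prems in auto)
qed (simp_all add: init_state_def)

definition payloads :: "'m set" where
  "payloads = {m. \<exists>t p. of_bcast \<rho> t p m}"

text \<open>By integrity the lists contain nothing but broadcast payloads, so all have the same set
  of payloads and C[m] = n. As f \<le> n and \<kappa> is nonnegative, every vertex is stable and the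
  loop empties the graph.\<close>

lemma complete_round_delivers:
  assumes all: "Cor = UNIV" and r: "1 \<le> r" "r < rnd (st \<rho> t p)"
    and complete: "\<And>k. payloads \<subseteq> set (seg r k)"
  shows "payloads \<subseteq> \<Union> (set (rlog (Suc r)))"
proof -
  define D where "D = \<Union> (set (rlog r))"
  have "set (seg r k) \<subseteq> payloads" for k
  proof
    fix m assume "m \<in> set (seg r k)"
    then obtain i where i: "i < cut_at r k" "m = msg_at k i" unfolding seg_def by auto
    then have "i < length (msgs (st \<rho> t p) k)" using finished_round[OF _ r] all
      by (meson UNIV_I less_le_trans)
    then show "m \<in> payloads" using msg_at_broadcast[of p k i t] all i(2) unfolding payloads_def
      by auto
  qed
  then have seg: "set (seg r k) = payloads" for k using complete by blast
  have "pool r D \<subseteq> \<Union> (set (batch r D))"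
  proof (rule round_batch_complete[OF select_in finite_pool round_batch_batch])
    fix m assume "m \<in> pool r D"
    then have "C_count (seg r) m = CARD('p)" unfolding pool_def C_count_def using seg by auto
    moreover have "faults \<pi> \<le> CARD('p)" using resilience by simp
    ultimately show "(real CARD('p) + real (faults \<pi>) - kappa \<pi>) / 2 \<le> real (C_count (seg r) m)"
      using kappa_nonneg by simp
  qed
  moreover have "payloads = pool r D \<union> payloads \<inter> D" unfolding pool_def using seg by auto
  ultimately have "payloads \<subseteq> D \<union> \<Union> (set (batch r D))" by blast
  then show ?thesis using r(1) unfolding D_def by simp
qed

lemma weak_validity: "of_weak_validity Cor (of_bcast \<rho>) (of_log \<rho>)"
proof -
  have "of_delivers (of_log \<rho>) p m"
    if all: "Cor = UNIV" and fin: "finite payloads" and m: "m \<in> payloads" for p m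
  proof -
    have cor: "q \<in> Cor" for q using all by simp
    have goal: ?thesis if r: "1 \<le> r" "r < rnd (st \<rho> t q)" "\<And>k. payloads \<subseteq> set (seg r k)" for r t q
    proof -
      obtain t' where "Suc r \<le> rnd (st \<rho> t' p)"
        using rounds_reached[OF cor, of "Suc r" t q p] r(2) cor by auto
      then have "\<Union> (set (rlog (Suc r))) \<subseteq> \<Union> (set (of_log \<rho> t' p))"
        unfolding of_log_eq_rlog[OF cor] using set_mono_prefix[OF rlog_mono] by blast
      then show ?thesis using complete_round_delivers[OF all r] m unfolding of_delivers_def by blast
    qed
    have "\<forall>\<^sub>F t in sequentially. x \<in> set (msgs (st \<rho> t q) k)" if x: "x \<in> payloads" for x q k
    proof -
      obtain t0 where "of_bcast \<rho> t0 k x"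
        using x all_bcast cor unfolding payloads_def all_correct_broadcast_def by blast
      then obtain t1 where "x \<in> set (msgs (st \<rho> t1 q) k)"
        using channel cor unfolding bcch_channel_def bcch_validity_def by blast
      then show ?thesis
        unfolding eventually_sequentially using set_mono_prefix[OF state_mono(1)] by blast
    qed
    then have "\<forall>\<^sub>F t in sequentially. \<forall>q k. \<forall>x\<in>payloads. x \<in> set (msgs (st \<rho> t q) k)"
      using fin by (intro eventually_all_finite eventually_ball_finite) auto
    \<comment> \<open>From \<open>T\<close> on every process holds every payload from every sender;
      this is where finiteness of the set of payloads enters.\<close>
    then obtain T where T: "\<And>t q k. t \<ge> T \<Longrightarrow> payloads \<subseteq> set (msgs (st \<rho> t q) k)"
      unfolding eventually_sequentially by blast
    have covered: "payloads \<subseteq> set (seg r k)"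
      if "t \<ge> T" "length (msgs (st \<rho> t q) k) \<le> cut_at r k" for t q r k
    proof -
      have "set (msgs (st \<rho> t q) k) = msg_at k ` {..<length (msgs (st \<rho> t q) k)}"
        using take_msgs[OF cor order_refl, of t q k] by (metis atLeast_upt image_set take_all_iff order_refl)
      also have "\<dots> \<subseteq> set (seg r k)" using that(2) unfolding seg_def by auto
      finally show ?thesis using T[OF that(1)] by blast
    qed
    show ?thesis
    proof (cases "\<forall>r. \<exists>q t. r \<le> rnd (st \<rho> t q)")
      case True
      \<comment> \<open>A round that no process has reached at time \<open>T\<close>, so all clocks
        of this round are signed after \<open>T\<close>.\<close>
      define r where "r = Suc (Max (range (\<lambda>q. rnd (st \<rho> T q))))"
      have r: "1 \<le> r" "rnd (st \<rho> T q) < r" for q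
        unfolding r_def by (simp_all add: less_Suc_eq_le)
      obtain q t where qt: "Suc r \<le> rnd (st \<rho> t q)" using True by blast
      then have "cuts (st \<rho> t q) r = Some (cut_at r)" using finished_round[OF cor r(1)] by simp
      then obtain v where dec: "vbc_decided r v" using cuts_decided[OF cor] by blast
      have "payloads \<subseteq> set (seg r k)" for k
      proof -
        \<comment> \<open>The shortest list from \<open>k\<close> at time \<open>T\<close> already
          contains all payloads, and its length is a lower bound for every clock of the
          round.\<close>
        obtain q' where q': "\<And>i. length (msgs (st \<rho> T q') k) \<le> length (msgs (st \<rho> T i) k)"
          using ex_has_least_nat[of "\<lambda>_. True" q "\<lambda>q. length (msgs (st \<rho> T q) k)"] by blast
        have "length (msgs (st \<rho> T q') k) \<le> vc (st \<rho> t i) k" if "round_start i t r" for i t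
        proof -
          have "rnd (st \<rho> t i) = r" using that unfolding round_start_def by simp
          then have "T \<le> t" using r(2)[of i] state_mono(2)[of t T i] by force
          then have "length (msgs (st \<rho> T i) k) \<le> vc (st \<rho> t i) k"
            using length_msgs_mono[of T t i k] vc_eq_length[OF cor] by simp
          then show ?thesis using q'[of i] by simp
        qed
        then have "length (msgs (st \<rho> T q') k) \<le> cut_at r k"
          by (rule all_correct_cut_ge[OF all dec])
        then show ?thesis using covered by blast
      qed
      then show ?thesis using goal[OF r(1), of t q] qt by simp
    next
      case False
      \<comment> \<open>\<open>R\<close> is the least bound that no process reaches, so its
        predecessor \<open>r\<close> is the round in which all processes are stuck.\<close>
      then obtain R where R: "\<forall>q t. rnd (st \<rho> t q) < R"
        "\<forall>R'<R. \<exists>q t. R' \<le> rnd (st \<rho> t q)"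
        using exists_least_iff[of "\<lambda>r. \<forall>q t. rnd (st \<rho> t q) < r"] by (auto simp: not_less not_le)
      then obtain r where R_Suc: "R = Suc r" by (metis not_less_zero old.nat.exhaust)
      have le: "rnd (st \<rho> t q) \<le> r" for t q using R(1) unfolding R_Suc less_Suc_eq_le by blast
      have r: "1 \<le> r" using le[of 0 undefined] rnd_pos[OF cor, of 0] order_trans by blast
      obtain q0 s0 where "r \<le> rnd (st \<rho> s0 q0)" using R(2) unfolding R_Suc by blast
      then have reach: "\<exists>t. r \<le> rnd (st \<rho> t q)" for q using rounds_reached[OF cor _ cor] by blast
      have undecided: "\<not> vbc_decided r v" for v
      proof
        assume dec: "vbc_decided r v"
        have "\<exists>t. Suc r \<le> rnd (st \<rho> t p)"
          by (rule round_progress[OF dec r reach all_correct_cut_available[OF all dec] cor])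
        then show False using le by (metis not_less_eq_eq)
      qed
      have no_proposal: "rnd (st \<rho> t q) \<noteq> r" if e: "ev \<rho> t = Some (q, Propose)" for t q
      proof
        assume "rnd (st \<rho> t q) = r"
        then have "\<exists>v. vbc_proposes \<rho> t q r v" unfolding vbc_proposes_def using e by blast
        then show False
          using consensus cor undecided
          unfolding validated_consensus_def vbc_termination_def vbc_decided_def by meson
      qed
      \<comment> \<open>Without a decision in round \<open>r\<close>, the variable
        \<open>cut\<close> keeps the value from the previous round, or its initial value 0,
        throughout.\<close>
      define c0 where "c0 = (if r = 1 then \<lambda>_. 0 else cut_at (r - 1))"
      have cut: "cut (st \<rho> t q) = c0" if "rnd (st \<rho> t q) = r" for t q
        using current_cut[OF cor, of t q] cuts_decided[OF cor, of t q r] undecided that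
        unfolding c0_def by (metis not_None_eq)
      have ex_stay: "\<exists>Tq. \<forall>t\<ge>Tq. rnd (st \<rho> t q) = r" for q
        using reach[of q] le[of _ q] state_mono(2)[of _ _ q] by (meson dual_order.antisym order_trans)
      show ?thesis
      \<comment> \<open>Either some process never sees a message above the old cut, or every process
        has a reason to start the round.\<close>
      proof (cases "\<exists>q. \<forall>t. rnd (st \<rho> t q) = r \<longrightarrow> (\<forall>k. length (msgs (st \<rho> t q) k) \<le> c0 k)")
        case True
        then obtain q where q: "\<And>t k. rnd (st \<rho> t q) = r \<Longrightarrow> length (msgs (st \<rho> t q) k) \<le> c0 k"
          by blast
        obtain Tq where Tq: "\<forall>t\<ge>Tq. rnd (st \<rho> t q) = r" using ex_stay by blast
        define t where "t = max T Tq"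
        have t: "t \<ge> T" "rnd (st \<rho> t q) = r" unfolding t_def using Tq by simp_all
        show ?thesis
        proof (cases "r = 1")
          case True
          \<comment> \<open>In round 1 the old cut is 0, so the lists of \<open>q\<close> would be
            empty although they contain \<open>m\<close>.\<close>
          then show ?thesis using q[OF t(2), of p] T[OF t(1), of q p] m unfolding c0_def by auto
        next
          case False
          then have "length (msgs (st \<rho> t q) k) \<le> cut_at (r - 1) k" for k
            using q[OF t(2), of k] unfolding c0_def by simp
          then have "payloads \<subseteq> set (seg (r - 1) k)" for k using covered[OF t(1)] by blast
          moreover have "1 \<le> r - 1" "r - 1 < rnd (st \<rho> t q)" using r t(2) False by simp_all
          ultimately show ?thesis using goal by blast
        qed
      next
        case False
        \<comment> \<open>All processes starting the round is contradictory: every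
          \<open>STATUS\<close> message reaches \<open>p\<close>, which would then propose, and
          termination of consensus would give a decision.\<close>
        have start: "\<exists>t. round_start q t r" for q
        proof -
          obtain t0 k where t0: "rnd (st \<rho> t0 q) = r" "c0 k < length (msgs (st \<rho> t0 q) k)"
            using False by (meson not_le)
          have later: "rnd (st \<rho> t q) = r" "c0 k < length (msgs (st \<rho> t q) k)" if "t \<ge> t0" for t
            using le[of t q] state_mono(2)[OF that, of q] length_msgs_mono[OF that, of q k] t0
            by simp_all
          show ?thesis
          proof (cases "\<exists>t\<ge>t0. inround (st \<rho> t q)")
            case True
            then show ?thesis using inround_started[OF cor] later(1) by metis
          next
            case False
            have enabled: "\<exists>s' out. lstep \<pi> q StartRound (st \<rho> t q) s' out" if "t \<ge> t0" for t
              using lstep.start_round[of "st \<rho> t q" \<pi> q] False later[OF that] cut[of t q] that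
              by auto
            obtain t where "t \<ge> t0" "ev \<rho> t = Some (q, StartRound)"
              by (rule handler_fires[OF cor, of StartRound t0]) (simp, (use enabled in blast)+)
            then show ?thesis using later(1) unfolding round_start_def by blast
          qed
        qed
        obtain Tp where Tp: "\<And>t. t \<ge> Tp \<Longrightarrow> rnd (st \<rho> t p) = r" using ex_stay by blast
        have "\<exists>t0. \<forall>t\<ge>t0. Sigma (st \<rho> t p) q \<noteq> None" for q
        proof -
          obtain t1 where t1: "ev \<rho> t1 = Some (q, StartRound)" "rnd (st \<rho> t1 q) = r"
            using start unfolding round_start_def by blast
          define v where "v = vc (st \<rho> t1 q)"
          have sent: "STATUS r v (sign \<pi> q v) \<in> set (out p)"
            if "lstep \<pi> q StartRound (st \<rho> t1 q) s' out" for s' out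
            using that t1(2) unfolding v_def by cases auto
          obtain t2 where t2: "(q, STATUS r v (sign \<pi> q v)) \<in> inbox (st \<rho> t2 p)"
            by (rule sent_received[OF t1(1) cor]) (use sent in blast)+
          have enabled: "\<exists>s' out. lstep \<pi> p (handler_of q (STATUS r v (sign \<pi> q v))) (st \<rho> t p) s' out"
            if "t \<ge> Tp" "(q, STATUS r v (sign \<pi> q v)) \<in> inbox (st \<rho> t p)" for t
            using lstep.handle_status[OF that(2)] Tp[OF that(1)] params unfolding params_ok_def
            by fastforce
          obtain t3 out where step: "lstep \<pi> p (HandleStatus q r v (sign \<pi> q v)) (st \<rho> t3 p)
              (st \<rho> (Suc t3) p) out"
            using message_handled[OF cor t2 enabled] by (metis handler_of.simps(1))
          then have t3: "rnd (st \<rho> t3 p) = r" "Sigma (st \<rho> (Suc t3) p) q \<noteq> None"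
            by (cases, auto)+
          \<comment> \<open>Only \<open>Propose\<close> clears signatures, and it does not occur in
            the stuck round, so the entries accumulate.\<close>
          have "Sigma (st \<rho> t p) q \<noteq> None" if "t \<ge> Suc t3" for t
            using that
          proof (induction rule: dec_induct)
            case (step t)
            have "rnd (st \<rho> t p) = r" using le[of t p] state_mono(2)[of t3 t p] step.hyps t3(1) by simp
            then have no: "ev \<rho> t \<noteq> Some (p, Propose)" using no_proposal by blast
            show ?case
            proof (rule state_step_cases[of t p])
              fix a out
              assume "ev \<rho> t = Some (p, a)" "lstep \<pi> p a (st \<rho> t p) (st \<rho> (Suc t) p) out"
              then show ?thesis using no step.IH by - (erule lstep.cases, auto)
            qed (use step.IH in simp)
          qed (rule t3(2))
          then show ?thesis by blast
        qed
        then have "\<forall>q. \<forall>\<^sub>F t in sequentially. Sigma (st \<rho> t p) q \<noteq> None"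
          unfolding eventually_sequentially by blast
        then have "\<forall>\<^sub>F t in sequentially. \<forall>q. Sigma (st \<rho> t p) q \<noteq> None"
          by (intro eventually_all_finite) simp
        then obtain T1 where T1: "\<And>t q. t \<ge> T1 \<Longrightarrow> Sigma (st \<rho> t p) q \<noteq> None"
          unfolding eventually_sequentially by blast
        have enabled: "\<exists>s' out. lstep \<pi> p Propose (st \<rho> t p) s' out" if "t \<ge> max T1 Tp" for t
        proof -
          have "{j. Sigma (st \<rho> t p) j \<noteq> None} = UNIV" using T1[of t] that by auto
          then show ?thesis using lstep.propose[of \<pi> "st \<rho> t p" p] by fastforce
        qed
        obtain t where "t \<ge> max T1 Tp" "ev \<rho> t = Some (p, Propose)"
          by (rule handler_fires[OF cor, of Propose "max T1 Tp"]) (simp, (use enabled in blast)+)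
        then show ?thesis using no_proposal[of t p] Tp[of t] by simp
      qed
    qed
  qed
  then show ?thesis unfolding of_weak_validity_def payloads_def by blast
qed

end

theorem theorem11:
  fixes \<pi> :: "('p::finite, 'm, 'sig, 'str) params"
    and Cor :: "'p set"
    and \<rho> :: "('p, 'm, 'sig, 'str) run"
  assumes "CARD('p) > 3 * faults \<pi>"
    and "kappa \<pi> \<ge> 0"
    and "card (- Cor) \<le> faults \<pi>"
    and "params_ok \<pi>"
    and "protocol_run \<pi> Cor \<rho>"
    and "fair_run \<pi> Cor \<rho>"
    and "signatures_secure \<pi> Cor \<rho>"
    and "bcch_channel \<pi> Cor \<rho>"
    and "validated_consensus \<pi> Cor \<rho>"
    and "all_correct_broadcast Cor (of_bcast \<rho>)"
  shows "differentially_order_fair_atomic_broadcast (faults \<pi>) (kappa \<pi>) Cor (of_bcast \<rho>) (of_log \<rho>)"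
proof -
  interpret ofab_execution \<pi> Cor \<rho>
    using assms by unfold_locales
  show ?thesis
    unfolding differentially_order_fair_atomic_broadcast_def
    using no_duplication agreement total_order weak_validity differential_order_fairness by blast
qed

end
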